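(* Let $\{(x^k,\eta^k)\}$ be generated by algorithm iRPMVR, suppose the error-dissipation condition holds (with constants $c_e,\mu,\nu$ and random variables $\mathcal E_k$), and suppose the inner tolerances satisfy, with $\eta^{-1}:=0$, some $\kappa\ge0$ and a deterministic sequence $\{\varsigma_k\}\subseteq[0,\bar\Delta]$, $$\Delta_k=\min\bigl\{\bar\Delta,\max\{\kappa\|\eta^{k-1}\|^2,\varsigma_k\}\bigr\},\qquad k\in\mathbb N.$$ Assume $$0<\bar\alpha<\min\bigl\{C_\alpha,\ 1/(L_F+2L_R+2\sqrt{\nu/\gamma}+4\ell_RC_0\kappa/\gamma)\bigr\}.$$ Let $\sigma_0:=\frac1{2\alpha}-\frac{L_F}2-L_R$, $\tau:=\sqrt{\nu/\gamma}$, $\mathcal L_k:=\Phi(x^k)+c_e\mathcal E_k/(2\tau)$, $a_\eta:=\gamma(\sigma_0-\tau/2)-\nu/(2\tau)-2\ell_RC_0\kappa$ and $a_{\hat\eta}:=\gamma/(2\alpha)$. Then $a_\eta>0$. Assume further that $\sum_{k=0}^\infty\varsigma_k<+\infty$, and define $$\widetilde C:=\Phi(x^0)-\inf_{x\in\mathcal M}\Phi(x)+2\ell_RC_0\sum_{k=0}^\infty\varsigma_k,\qquad C_\Theta:=1+2(\ell_f+\alpha^{-1})^2,\qquad C_{\rm comp}:=\max\{C_\Theta/a_{\hat\eta},\,2\nu/a_\eta\}.$$ Then: (i) For every $K\ge1$, $\displaystyle\sum_{k=0}^{K-1}\mathbb E[\Theta_k^2]\le C_{\rm comp}\widetilde C+c_e\Bigl(2+\frac{C_{\rm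 comp}}{2\tau}\Bigr)\mathbb E[\mathcal E_0]$. (ii) The algorithm produces an iterate satisfying $\min_{0\le k\le K-1}\mathbb E[\Theta_k^2]\le\epsilon^2$ within $O\bigl([C_{\rm comp}+c_e(1+C_{\rm comp}/\tau)\mathbb E[\mathcal E_0]]\,\epsilon^{-2}\bigr)$ outer iterations.
   Context: Setting. $\mathcal M\subseteq\mathbb R^d$ is a compact embedded Riemannian submanifold (induced Euclidean metric) of dimension $d-p$, with tangent spaces $T_x\mathcal M$, normal spaces $N_x\mathcal M=(T_x\mathcal M)^\perp$, tangent bundle $T\mathcal M=\{(x,\eta):x\in\mathcal M,\eta\in T_x\mathcal M\}$; $P_S$ is Euclidean projection onto a closed convex set $S$. $\Phi=F+R$, $F=\frac1n\sum_{j=1}^nf_j$. Each $f_j:\mathbb R^d\to\mathbb R$ is $C^1$; there is an open neighborhood $U$ of $\mathcal M$ on which every $\nabla f_j$ is Lipschitz with common constant $\ell_f$; $\|\nabla f_j(x)\|\le M_f$ for all $x\in\mathcal M$ and all $j$ ($M_f>0$ independent of $n$); $R:\mathbb R^d\to\mathbb R$ is convex and $\ell_R$-Lipschitz. $\operatorname{grad}h(x)=P_{T_x\mathcal M}\nabla h(x)$. $\operatorname{Retr}:T\mathcal M\to\mathcal M$ is a retraction (smooth, $\operatorname{Retr}_x(0)=x$, $D\operatorname{Retr}_x(0)=\mathrm{Id}$). $\mathcal M$ is covered by finitely many open sets $V_\ell$ with $\overline{V_\ell}\subseteq U_\ell$, $U_\ell$ open carrying smooth local defining functions $\psi_\ell:U_\ell\to\mathbb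 R^p$ of $\mathcal M$ whose differential has full row rank on $U_\ell\cap\mathcal M$; for $x\in\mathcal M$ pick $\ell(x)$ with $x\in V_{\ell(x)}$ and set $B_x:=D\psi_{\ell(x)}(x)$, so $\ker B_x=T_x\mathcal M$. $C_0>0$ is a constant with $\operatorname{dist}(v,T_x\mathcal M)\le C_0\|B_xv\|$ for all $x\in\mathcal M$, $v\in\mathbb R^d$. Algorithm iRPMVR. Choose $x^0\in\mathcal M$, stepsize $0<\alpha\le\bar\alpha$, $0<\gamma\le1$, $\bar\Delta\ge0$, $0\le\bar\chi<1$, $M_u:=c_fM_f$ with $c_f\ge1$. Parameters $\gamma_k\in[\gamma,1]$, $\Delta_k\in[0,\bar\Delta]$, $\chi_k\in[0,\bar\chi]$ are chosen before sampling the $k$-th batch using only available history. Initialize $u^0=\hat u^0=\bar m^0=\operatorname{grad}F(x^0)$. For $k=0,1,\dots$ (outer iterations): (a) if $k\ne0$, sample a random batch $\mathcal B_k$ from $\{1,\dots,n\}$, form from it and the current estimator state an estimator $u^k\in T_{x^k}\mathcal M$ of $\operatorname{grad}F(x^k)$, and set $\hat u^k=P_{\overline B(0,M_u)}u^k$; (b) $m^k=\chi_k\bar m^k+(1-\chi_k)\hat u^k$; (c) with $F_k(\eta):=\langle m^k,\eta\rangle+\frac1{2\alpha}\|\eta\|^2+R(x^k+\eta)$ and $G_k(\lambda):=F_k^*(-B_{x^k}^\top\lambda)$ ($F_k^*$ the Fenchel conjugate) find $\lambda^k\in\mathbb R^p$ with $\|\nabla G_k(\lambda^k)\|\le\Delta_k$;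 (d) $w^k=\operatorname{prox}_{\alpha R}(x^k-\alpha(m^k+B_{x^k}^\top\lambda^k))-x^k$, $\eta^k=P_{T_{x^k}\mathcal M}w^k$; (e) $x^{k+1}=\operatorname{Retr}_{x^k}(\gamma_k\eta^k)$; (f) $\bar m^{k+1}=P_{T_{x^{k+1}}\mathcal M}m^k$. The exact tangent step is $\hat\eta^k:=\arg\min_{\eta\in T_{x^k}\mathcal M}F_k(\eta)$ and $e^k:=m^k-\operatorname{grad}F(x^k)$. $\mathcal F_k$ is the natural filtration of the history before $\mathcal B_k$ is sampled (so $x^k,\bar m^k,\gamma_k,\Delta_k,\chi_k$ are $\mathcal F_k$-measurable); $\mathbb E_k=\mathbb E[\cdot\mid\mathcal F_k]$. Error-dissipation condition: there are constants $c_e,\mu,\nu>0$ and nonnegative $\mathcal F_k$-measurable random variables $\mathcal E_k$, $\mathbb E[\mathcal E_0]<\infty$, with $\mathbb E_k[\|e^k\|^2]+\mu\mathcal E_k\le c_e(\mathcal E_k-\mathbb E_k[\mathcal E_{k+1}])+\nu\mathbb E_k[\|\eta^k\|^2]$ for every $k\ge0$. Criticality measure: for $x\in\mathcal M$, $\eta\in T_x\mathcal M$, $\Theta(x,\eta):=\sqrt{\operatorname{dist}^2(0,\nabla F(x+\eta)+\partial R(x+\eta)+N_x\mathcal M)+\|\eta\|^2}$, and $\Theta_k:=\Theta(x^k,\hat\eta^k)$. Constants. $\delta,C_R,C_Q,L_R,L_\Phi,L_F>0$ are fixed such that for all $x\in\mathcal M$, $\eta\in T_x\mathcal M$, $\|\eta\|\le\delta$: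 $\|\operatorname{Retr}_x(\eta)-x\|\le C_R\|\eta\|$, $\|\operatorname{Retr}_x(\eta)-x-\eta\|\le C_Q\|\eta\|^2$, $|R(\operatorname{Retr}_x(\eta))-R(x+\eta)|\le L_R\|\eta\|^2$, $|\Phi(\operatorname{Retr}_x(\eta))-\Phi(x+\eta)|\le L_\Phi\|\eta\|^2$, $F(\operatorname{Retr}_x(\eta))-F(x)-\langle\operatorname{grad}F(x),\eta\rangle\le\frac{L_F}2\|\eta\|^2$. $\delta_T,L_T>0$ are fixed such that, for all $j$ (and likewise for $F$ in place of $f_j$), $\|\operatorname{grad}f_j(\operatorname{Retr}_x(\eta))-P_{T_{\operatorname{Retr}_x(\eta)}\mathcal M}\operatorname{grad}f_j(x)\|\le L_T\|\eta\|$ for $x\in\mathcal M$, $\eta\in T_x\mathcal M$ with $\|\eta\|\le\delta_T$, and $\|\operatorname{grad}f_j(y^i)-P_{T_{y^i}\mathcal M}\operatorname{grad}f_j(y^0)\|\le L_T\sum_{k=0}^{i-1}\|\zeta^k\|$ whenever $y^{k+1}=\operatorname{Retr}_{y^k}(\zeta^k)$ with $y^k\in\mathcal M$, $\zeta^k\in T_{y^k}\mathcal M$, $\|\zeta^k\|\le\delta_T$ for $k=0,\dots,i-1$. Finally $$C_\alpha:=\left(\frac{\sqrt{\ell_RC_0\bar\Delta+(M_u+\ell_R)\min\{\delta,\delta_T\}}-\sqrt{\ell_RC_0\bar\Delta}}{M_u+\ell_R}\right)^2.$$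
   Formalization: The choice of δ additionally requires that x+η lies in the neighborhood U on which all ∇f_j are Lipschitz, for x∈M, η∈T_xM, ‖η‖≤δ; without this ∇F(x^k+η̂^k) is uncontrolled and (i) can fail. *)

theory Defs
  imports "HOL-Analysis.Analysis" "HOL-Probability.Probability"
begin

section \<open>Calculus\<close>

definition nabla :: "('a::real_inner \<Rightarrow> real) \<Rightarrow> 'a \<Rightarrow> 'a" where
  "nabla h x = (THE g. GDERIV h x :> g)"

definition C1_fun :: "('a::real_inner \<Rightarrow> real) \<Rightarrow> bool" where
  "C1_fun h \<longleftrightarrow> (\<forall>x. h differentiable (at x)) \<and> continuous_on UNIV (nabla h)"

text \<open>For open \<open>S\<close> in a finite-dimensional space, \<open>Ck_on k S h\<close> is \<open>C\<^sup>k\<close> regularity on \<open>S\<close>: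
  all iterated directional derivatives up to order \<open>k\<close> exist and are continuous.\<close>

primrec Ck_on :: "nat \<Rightarrow> 'a::real_normed_vector set \<Rightarrow> ('a \<Rightarrow> 'b::real_normed_vector) \<Rightarrow> bool" where
  "Ck_on 0 S h \<longleftrightarrow> continuous_on S h"
| "Ck_on (Suc k) S h \<longleftrightarrow>
     (\<forall>x\<in>S. h differentiable (at x)) \<and> (\<forall>v. Ck_on k S (\<lambda>x. frechet_derivative h (at x) v))"

text \<open>Smoothness on an arbitrary set: local existence of \<open>C\<^sup>\<infinity>\<close> extensions to open sets of the
  ambient space. This is used for maps on the tangent bundle, which is not open.\<close>

definition smooth_on :: "'a::real_normed_vector set \<Rightarrow> ('a \<Rightarrow> 'b::real_normed_vector) \<Rightarrow> bool" where
  "smooth_on S h \<longleftrightarrow>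
     (\<forall>x\<in>S. \<exists>W g. open W \<and> x \<in> W \<and> (\<forall>k. Ck_on k W g) \<and> (\<forall>y\<in>S \<inter> W. g y = h y))"

section \<open>Convex analysis\<close>

definition subdifferential :: "('a::real_inner \<Rightarrow> real) \<Rightarrow> 'a \<Rightarrow> 'a set" where
  "subdifferential R x = {g. \<forall>y. R x + g \<bullet> (y - x) \<le> R y}"

text \<open>\<open>prox a R\<close> is the proximal map of \<open>a R\<close>. The objective is the usual one divided by \<open>a > 0\<close>.\<close>

definition prox :: "real \<Rightarrow> ('a::real_inner \<Rightarrow> real) \<Rightarrow> 'a \<Rightarrow> 'a" where
  "prox a R z = (ARG_MIN (\<lambda>y. R y + (norm (y - z))\<^sup>2 / (2 * a)) y. True)"

text \<open>The supremum is a real one, so this is the Fenchel conjugate only where that is finite. It is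
  applied only to strongly convex functions, whose conjugate is finite everywhere.\<close>

definition fenchel_conj :: "('a::real_inner \<Rightarrow> real) \<Rightarrow> 'a \<Rightarrow> real" where
  "fenchel_conj h s = (SUP y. s \<bullet> y - h y)"

section \<open>Embedded submanifolds\<close>

text \<open>\<open>psi\<close> is a smooth local defining function of \<open>M\<close> on \<open>U\<close>. If such pairs exist around every point
  of \<open>M\<close>, then \<open>M\<close> is an embedded submanifold of dimension \<open>CARD('d) - CARD('p)\<close>.\<close>

definition local_defining ::
    "(real^'d) set \<Rightarrow> (real^'d) set \<Rightarrow> (real^'d \<Rightarrow> real^'p) \<Rightarrow> bool" where
  "local_defining M U psi \<longleftrightarrow>
     open U \<and> smooth_on U psi \<and> M \<inter> U = {x \<in> U. psi x = 0} \<and>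
     (\<forall>x \<in> U \<inter> M. rank (jacobian psi (at x)) = CARD('p))"

definition defining_cover ::
    "(real^'d) set \<Rightarrow> 'i set \<Rightarrow> ('i \<Rightarrow> (real^'d) set) \<Rightarrow> ('i \<Rightarrow> (real^'d) set)
     \<Rightarrow> ('i \<Rightarrow> real^'d \<Rightarrow> real^'p) \<Rightarrow> bool" where
  "defining_cover M I V U psi \<longleftrightarrow>
     finite I \<and> M \<subseteq> (\<Union>l\<in>I. V l) \<and>
     (\<forall>l\<in>I. open (V l) \<and> closure (V l) \<subseteq> U l \<and> local_defining M (U l) (psi l))"

text \<open>Tangent vectors are the velocities of smooth curves in \<open>M\<close>.\<close>

definition tangent_space :: "'a::real_normed_vector set \<Rightarrow> 'a \<Rightarrow> 'a set" where
  "tangent_space M x =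
     {v. \<exists>c e. 0 < e \<and> smooth_on {-e<..<e::real} c \<and> c ` {-e<..<e} \<subseteq> M \<and>
           c 0 = x \<and> (c has_vector_derivative v) (at 0)}"

definition normal_space :: "'a::euclidean_space set \<Rightarrow> 'a \<Rightarrow> 'a set" where
  "normal_space M x = orthogonal_comp (tangent_space M x)"

definition tangent_bundle :: "'a::real_normed_vector set \<Rightarrow> ('a \<times> 'a) set" where
  "tangent_bundle M = (SIGMA x:M. tangent_space M x)"

abbreviation proj_tangent :: "'a::euclidean_space set \<Rightarrow> 'a \<Rightarrow> 'a \<Rightarrow> 'a" where
  "proj_tangent M x \<equiv> closest_point (tangent_space M x)"

definition riem_grad :: "'a::euclidean_space set \<Rightarrow> ('a \<Rightarrow> real) \<Rightarrow> 'a \<Rightarrow> 'a" where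
  "riem_grad M h x = proj_tangent M x (nabla h x)"

definition manifold_retraction ::
    "'a::euclidean_space set \<Rightarrow> ('a \<Rightarrow> 'a \<Rightarrow> 'a) \<Rightarrow> bool" where
  "manifold_retraction M Retr \<longleftrightarrow>
     smooth_on (tangent_bundle M) (\<lambda>(x, v). Retr x v) \<and>
     (\<forall>(x, v) \<in> tangent_bundle M. Retr x v \<in> M) \<and>
     (\<forall>x\<in>M. Retr x 0 = x \<and> (Retr x has_derivative (\<lambda>v. v)) (at 0 within tangent_space M x))"

text \<open>The local Lipschitz properties of the Riemannian gradient of \<open>h\<close> along one retraction step and
  along chains of retraction steps.\<close>

definition grad_transport_lipschitz ::
    "'a::euclidean_space set \<Rightarrow> ('a \<Rightarrow> 'a \<Rightarrow> 'a) \<Rightarrow> real \<Rightarrow> real \<Rightarrow> ('a \<Rightarrow> real) \<Rightarrow> bool" where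
  "grad_transport_lipschitz M Retr d L h \<longleftrightarrow>
     (\<forall>x\<in>M. \<forall>v\<in>tangent_space M x. norm v \<le> d \<longrightarrow>
        norm (riem_grad M h (Retr x v) - proj_tangent M (Retr x v) (riem_grad M h x)) \<le> L * norm v) \<and>
     (\<forall>i y z. y 0 \<in> M \<and>
        (\<forall>k<i. y k \<in> M \<and> z k \<in> tangent_space M (y k) \<and> norm (z k) \<le> d \<and>
                y (Suc k) = Retr (y k) (z k)) \<longrightarrow>
        norm (riem_grad M h (y i) - proj_tangent M (y i) (riem_grad M h (y 0)))
          \<le> L * (\<Sum>k<i. norm (z k)))"

section \<open>The algorithm\<close>

definition tangent_model ::
    "real \<Rightarrow> ('a::real_inner \<Rightarrow> real) \<Rightarrow> 'a \<Rightarrow> 'a \<Rightarrow> 'a \<Rightarrow> real" where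
  "tangent_model \<alpha> R m x v = m \<bullet> v + (norm v)\<^sup>2 / (2 * \<alpha>) + R (x + v)"

definition dual_fun ::
    "real \<Rightarrow> (real^'d \<Rightarrow> real) \<Rightarrow> real^'d^'p \<Rightarrow> real^'d \<Rightarrow> real^'d \<Rightarrow> real^'p \<Rightarrow> real" where
  "dual_fun \<alpha> R B m x l = fenchel_conj (tangent_model \<alpha> R m x) (- (transpose B *v l))"

definition exact_step ::
    "'a::real_inner set \<Rightarrow> real \<Rightarrow> ('a \<Rightarrow> real) \<Rightarrow> 'a \<Rightarrow> 'a \<Rightarrow> 'a" where
  "exact_step M \<alpha> R m x = (ARG_MIN (tangent_model \<alpha> R m x) v. v \<in> tangent_space M x)"

text \<open>\<open>Theta F R M x v\<close> is the criticality measure. \<open>infdist\<close> of the empty set is 0, but the set below is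
  nonempty because a finite convex function on a Euclidean space has subgradients everywhere.\<close>

definition Theta ::
    "('a::euclidean_space \<Rightarrow> real) \<Rightarrow> ('a \<Rightarrow> real) \<Rightarrow> 'a set \<Rightarrow> 'a \<Rightarrow> 'a \<Rightarrow> real" where
  "Theta F R M x v =
     sqrt ((infdist 0 {nabla F (x + v) + g + w | g w.
              g \<in> subdifferential R (x + v) \<and> w \<in> normal_space M x})\<^sup>2 + (norm v)\<^sup>2)"

text \<open>In \<open>error_dissipation\<close> only \<open>Er 0\<close> is assumed integrable. \<open>real_cond_exp\<close> replaces an infinite
  conditional expectation of a nonnegative variable by 0, so finiteness of the conditional
  expectation of \<open>Er (Suc k)\<close>, implicit in the inequality, is stated explicitly.\<close>

definition error_dissipation ::
    "'w measure \<Rightarrow> (nat \<Rightarrow> 'w measure) \<Rightarrow> real \<Rightarrow> real \<Rightarrow> real \<Rightarrow> (nat \<Rightarrow> 'w \<Rightarrow> real)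
     \<Rightarrow> (nat \<Rightarrow> 'w \<Rightarrow> 'a::real_normed_vector) \<Rightarrow> (nat \<Rightarrow> 'w \<Rightarrow> 'a) \<Rightarrow> bool" where
  "error_dissipation P Fl c\<^sub>e \<mu> \<nu> Er err \<eta> \<longleftrightarrow>
     0 < c\<^sub>e \<and> 0 < \<mu> \<and> 0 < \<nu> \<and>
     (\<forall>k. Er k \<in> borel_measurable (Fl k)) \<and>
     (\<forall>k. \<forall>\<omega>\<in>space P. 0 \<le> Er k \<omega>) \<and>
     integrable P (Er 0) \<and>
     (\<forall>k. AE \<omega> in P.
        nn_cond_exp P (Fl k) (\<lambda>\<omega>. ennreal (Er (Suc k) \<omega>)) \<omega> < \<infinity> \<and>
        real_cond_exp P (Fl k) (\<lambda>\<omega>. (norm (err k \<omega>))\<^sup>2) \<omega> + \<mu> * Er k \<omega>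
          \<le> c\<^sub>e * (Er k \<omega> - real_cond_exp P (Fl k) (Er (Suc k)) \<omega>)
             + \<nu> * real_cond_exp P (Fl k) (\<lambda>\<omega>. (norm (\<eta> k \<omega>))\<^sup>2) \<omega>)"

end

theory Submission
  imports Defs
begin

text \<open>The primal point \<open>w\<close> minimises the model plus a linear functional that vanishes on the tangent
  space, and the dual residual is \<open>- B w\<close>. Hence \<open>w\<close> is within \<open>C\<^sub>0 \<Delta>\<close> of its projection \<open>\<eta>\<close>, and
  \<open>\<eta>\<close> minimises the model on the tangent space up to \<open>2 l\<^sub>R C\<^sub>0 \<Delta>\<close>. Strong convexity of the model at the
  exact step \<open>\<eta>hat\<close> then gives a decrease of \<open>\<Phi>\<close> proportional to both \<open>norm \<eta>\<close> and \<open>norm \<eta>hat\<close>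
  squared, up to the tolerance and the squared gradient error, which telescopes in expectation by
  error dissipation. Optimality of \<open>\<eta>hat\<close> bounds \<open>Theta\<close> by \<open>norm \<eta>hat\<close> and the gradient error.
  Since \<open>\<eta>hat\<close> is not known to be measurable, its square is replaced in all integrals by the measurable upper
  bound that the descent inequality provides.\<close>

section \<open>The proximal model on a subspace\<close>

text \<open>The stepsize restriction does two jobs. The bound by \<open>C\<^sub>\<alpha>\<close>
  keeps \<open>\<eta>\<close> and \<open>\<eta>hat\<close> within the radius
  \<open>min \<delta> \<delta>\<^sub>T\<close>: the retraction estimates then apply,
  \<open>x + \<eta>hat\<close> stays in \<open>Uf\<close>, where the gradient of \<open>F\<close> is
  Lipschitz, and the squared steps are bounded, hence integrable. The other bound yields
  \<open>0 < a\<^sub>\<eta>\<close>. The coefficient of the squared step has to pay three costs: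
  \<open>\<gamma>0 * \<tau> / 2\<close> for Young's inequality, \<open>\<nu> / (2 * \<tau>)\<close>
  when dissipation turns the gradient error back into steps, and
  \<open>2 * l\<^sub>R * C\<^sub>0 * \<kappa>\<close> for the tolerance of the following iteration.
  The first two have a product independent of \<tau>, so their sum is least when they agree, which
  is \<open>\<tau> = sqrt (\<nu> / \<gamma>0)\<close>. Two points need work beyond the descent
  argument. Measurability of the gradient error requires the tangent projection to depend
  continuously on the base point, although tangent spaces are given by curves. Integrability of
  \<open>Er k\<close> is known for \<open>k = 0\<close> only and has to be extracted from the
  dissipation inequality step by step.\<close>

lemma closest_point_subspace_in:
  fixes S :: "'a::euclidean_space set"
  assumes "subspace S"
  shows "closest_point S a \<in> S"
  using assms by (intro closest_point_in_set closed_subspace) (auto dest: subspace_0)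

lemma closest_point_subspace_orthogonal:
  fixes S :: "'a::euclidean_space set"
  assumes S: "subspace S" and z: "z \<in> S"
  shows "(a - closest_point S a) \<bullet> z = 0"
proof -
  let ?p = "closest_point S a"
  have p: "?p \<in> S" by (rule closest_point_subspace_in[OF S])
  have *: "(a - ?p) \<bullet> y \<le> 0" if "y \<in> S" for y
    using closest_point_dot[OF subspace_imp_convex[OF S] closed_subspace[OF S], of "?p + y" a]
      subspace_add[OF S p that] by simp
  from *[OF z] *[OF subspace_neg[OF S z]] show ?thesis by simp
qed

lemma closest_point_subspace_eqI:
  fixes S :: "'a::euclidean_space set"
  assumes S: "subspace S" and p: "p \<in> S" and o: "\<And>z. z \<in> S \<Longrightarrow> (a - p) \<bullet> z = 0"
  shows "closest_point S a = p"
proof -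
  let ?d = "closest_point S a - p"
  have d: "?d \<in> S" by (intro subspace_diff S p closest_point_subspace_in)
  have "?d \<bullet> ?d = (a - p) \<bullet> ?d - (a - closest_point S a) \<bullet> ?d"
    by (simp add: inner_diff_left)
  also have "\<dots> = 0" using o[OF d] closest_point_subspace_orthogonal[OF S d] by simp
  finally show ?thesis by simp
qed

lemma norm_closest_point_subspace_le:
  fixes S :: "'a::euclidean_space set"
  assumes S: "subspace S"
  shows "norm (closest_point S a) \<le> norm a"
proof (cases "closest_point S a = 0")
  case False
  let ?p = "closest_point S a"
  have "(norm ?p)\<^sup>2 = a \<bullet> ?p"
    using closest_point_subspace_orthogonal[OF S closest_point_subspace_in[OF S], of a a]
    by (simp add: power2_norm_eq_inner inner_diff_left)
  also have "\<dots> \<le> norm a * norm ?p" by (rule norm_cauchy_schwarz)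
  finally show ?thesis using False by (simp add: power2_eq_square)
qed simp

text \<open>This keeps the clipped estimator tangent. Projecting \<open>?p\<close> onto
  \<open>S\<close> stays in the ball, and by Pythagoras it moves strictly closer to \<open>a\<close>
  unless \<open>?p\<close> already lies in \<open>S\<close>.\<close>

lemma closest_point_cball_subspace:
  fixes S :: "'a::euclidean_space set"
  assumes S: "subspace S" and a: "a \<in> S" and r: "0 \<le> r"
  shows "closest_point (cball 0 r) a \<in> S" "norm (closest_point (cball 0 r) a) \<le> r"
proof -
  let ?C = "cball 0 r :: 'a set"
  let ?p = "closest_point ?C a"
  have pC: "?p \<in> ?C" using r by (intro closest_point_in_set) auto
  then show n: "norm ?p \<le> r" by simp
  let ?q = "closest_point S ?p"
  have qS: "?q \<in> S" by (rule closest_point_subspace_in[OF S])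
  have qC: "?q \<in> ?C" using norm_closest_point_subspace_le[OF S, of ?p] n by simp
  have "(norm (a - ?p))\<^sup>2 = (norm (a - ?q))\<^sup>2 + (norm (?p - ?q))\<^sup>2"
    using closest_point_subspace_orthogonal[OF S subspace_diff[OF S a qS], of ?p]
    by (simp add: power2_norm_eq_inner inner_diff_left inner_diff_right inner_commute algebra_simps)
  moreover have "(norm (a - ?p))\<^sup>2 \<le> (norm (a - ?q))\<^sup>2"
    using closest_point_le[of ?C ?q a] qC by (simp add: dist_norm power_mono)
  ultimately have "?p = ?q" by simp
  with qS show "?p \<in> S" by simp
qed

section \<open>Gradients of real functions\<close>

lemma nabla_eqI: "GDERIV h x :> g \<Longrightarrow> nabla h x = g"
proof -
  assume g: "GDERIV h x :> g"
  have "g' = g" if "GDERIV h x :> g'" for g'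
  proof -
    have "(\<lambda>v. v \<bullet> g') = (\<lambda>v. v \<bullet> g)"
      using g that unfolding gderiv_def by (rule has_derivative_unique[rotated])
    then have "(g' - g) \<bullet> (g' - g) = 0" by (simp add: fun_eq_iff inner_diff_right)
    then show ?thesis by simp
  qed
  with g show ?thesis unfolding nabla_def by blast
qed

lemma differentiable_imp_GDERIV:
  fixes h :: "'a::euclidean_space \<Rightarrow> real"
  assumes "h differentiable (at x)"
  shows "GDERIV h x :> nabla h x"
proof -
  from assms obtain D where D: "(h has_derivative D) (at x)" unfolding differentiable_def by blast
  \<comment> \<open>The Riesz vector of the functional \<open>D\<close> is its adjoint evaluated at
    1.\<close>
  have "D = (\<lambda>v. v \<bullet> adjoint D 1)"
    using adjoint_works[OF has_derivative_linear[OF D], of _ 1] by (simp add: fun_eq_iff)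
  with D have "GDERIV h x :> adjoint D 1" unfolding gderiv_def by simp
  with nabla_eqI[OF this] show ?thesis by simp
qed

section \<open>Minimisers of the model and their optimality conditions\<close>

lemma lipschitz_on_real_abs_le:
  fixes R :: "'a::real_normed_vector \<Rightarrow> real"
  assumes "l-lipschitz_on UNIV R"
  shows "\<bar>R y - R z\<bar> \<le> l * norm (y - z)"
  using lipschitz_onD[OF assms, of y z] by (simp add: dist_norm)

text \<open>Compactness inside the ball of radius \<open>r\<close>, coercivity outside: beyond
  \<open>r\<close> the quadratic term dominates \<open>(norm c + l) * norm y\<close>, so no such
  point does better than 0.\<close>

lemma tangent_model_has_minimizer:
  fixes R :: "'a::euclidean_space \<Rightarrow> real"
  assumes S: "subspace S" and a: "0 < \<alpha>" and L: "l-lipschitz_on UNIV R"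
  shows "\<exists>v. is_arg_min (tangent_model \<alpha> R c x) (\<lambda>v. v \<in> S) v"
proof -
  define q where "q = tangent_model \<alpha> R c x"
  define r where "r = 2 * \<alpha> * (norm c + l)"
  have l: "0 \<le> l" using L by (rule lipschitz_on_nonneg)
  have "continuous_on (S \<inter> cball 0 r) q"
    unfolding q_def tangent_model_def
    using a by (intro continuous_intros continuous_on_compose2[OF lipschitz_on_continuous_on[OF L]]) auto
  moreover have "compact (S \<inter> cball 0 r)" by (simp add: closed_Int_compact closed_subspace[OF S])
  moreover have r: "0 \<le> r" using a l by (simp add: r_def)
  then have z: "0 \<in> S \<inter> cball 0 r" using subspace_0[OF S] by simp
  ultimately obtain v where v: "v \<in> S \<inter> cball 0 r" "\<And>y. y \<in> S \<inter> cball 0 r \<Longrightarrow> q v \<le> q y"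
    using continuous_attains_inf[of "S \<inter> cball 0 r" q] by blast
  have "q v \<le> q y" if y: "y \<in> S" for y
  proof (cases "norm y \<le> r")
    case False
    have "R x - R (x + y) \<le> l * norm y"
      using lipschitz_on_real_abs_le[OF L, of x "x + y"] by simp
    moreover have "- (norm c * norm y) \<le> c \<bullet> y" using Cauchy_Schwarz_ineq2[of c y] by simp
    moreover have "(norm c + l) * norm y \<le> (norm y)\<^sup>2 / (2 * \<alpha>)"
    proof -
      have "(norm c + l) * norm y = r * norm y / (2 * \<alpha>)" using a by (simp add: r_def)
      also have "\<dots> \<le> norm y * norm y / (2 * \<alpha>)"
        using False a by (intro divide_right_mono mult_right_mono) auto
      finally show ?thesis by (simp add: power2_eq_square)
    qed
    ultimately have "q 0 \<le> q y" by (simp add: q_def tangent_model_def algebra_simps)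
    with v(2)[OF z] show ?thesis by simp
  qed (use y in \<open>auto intro: v(2)\<close>)
  then show ?thesis using v(1) unfolding is_arg_min_def q_def[symmetric] by (auto simp: not_less)
qed

text \<open>First-order optimality without differentiability of \<open>R\<close>: moving from
  \<open>w\<close> a fraction \<open>t\<close> towards \<open>v\<close> changes the model by at most
  \<open>t * D\<close> plus a term of order \<open>t\<^sup>2\<close>; division by \<open>t\<close>
  and the limit at 0 leave \<open>D\<close>. Along \<open>S\<close>, the vector
  \<open>- (c + w /\<^sub>R \<alpha>)\<close> thus acts as a subgradient at
  \<open>x + w\<close>.\<close>

lemma tangent_model_minimizer_variational:
  fixes R :: "'a::euclidean_space \<Rightarrow> real"
  assumes S: "subspace S" and a: "0 < \<alpha>" and R: "convex_on UNIV R"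
    and w: "is_arg_min (tangent_model \<alpha> R c x) (\<lambda>v. v \<in> S) w" and v: "v \<in> S"
  shows "R (x + v) \<ge> R (x + w) - (c + w /\<^sub>R \<alpha>) \<bullet> (v - w)"
proof -
  define d where "d = v - w"
  define D where "D = R (x + v) - R (x + w) + (c + w /\<^sub>R \<alpha>) \<bullet> d"
  have wS: "w \<in> S" and wm: "\<And>y. y \<in> S \<Longrightarrow> tangent_model \<alpha> R c x w \<le> tangent_model \<alpha> R c x y"
    using w by (auto simp: is_arg_min_def not_less)
  have dS: "d \<in> S" unfolding d_def by (intro subspace_diff S v wS)
  have *: "0 \<le> D + t * ((norm d)\<^sup>2 / (2 * \<alpha>))" if t: "0 < t" "t \<le> 1" for t
  proof -
    have "tangent_model \<alpha> R c x w \<le> tangent_model \<alpha> R c x (w + t *\<^sub>R d)"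
      by (intro wm subspace_add subspace_scale S wS dS)
    moreover have "R (x + (w + t *\<^sub>R d)) \<le> (1 - t) * R (x + w) + t * R (x + v)"
    proof -
      have "x + (w + t *\<^sub>R d) = (1 - t) *\<^sub>R (x + w) + t *\<^sub>R (x + v)"
        by (simp add: d_def algebra_simps)
      then show ?thesis using convex_onD[OF R, of t "x + w" "x + v"] t by simp
    qed
    moreover have "(norm (w + t *\<^sub>R d))\<^sup>2 / (2 * \<alpha>)
        = (norm w)\<^sup>2 / (2 * \<alpha>) + t * ((w /\<^sub>R \<alpha>) \<bullet> d) + t * (t * ((norm d)\<^sup>2 / (2 * \<alpha>)))"
    proof -
      have "(norm (w + t *\<^sub>R d))\<^sup>2 = (norm w)\<^sup>2 + 2 * t * (w \<bullet> d) + t * (t * (norm d)\<^sup>2)"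
        by (simp add: power2_norm_eq_inner inner_add_left inner_add_right inner_commute algebra_simps)
      with a show ?thesis by (simp add: field_simps)
    qed
    ultimately have "0 \<le> t * (D + t * ((norm d)\<^sup>2 / (2 * \<alpha>)))"
      by (simp add: tangent_model_def D_def inner_add_right inner_add_left algebra_simps del: inner_scaleR_left)
    with t show ?thesis by (simp add: zero_le_mult_iff)
  qed
  have "((\<lambda>t. D + t * ((norm d)\<^sup>2 / (2 * \<alpha>))) \<longlongrightarrow> D + 0 * ((norm d)\<^sup>2 / (2 * \<alpha>))) (at_right 0)"
    by (intro tendsto_intros)
  then have "0 \<le> D + 0 * ((norm d)\<^sup>2 / (2 * \<alpha>))"
    by (rule tendsto_lowerbound)
      (use * in \<open>auto simp: eventually_at_right_field intro!: exI[of _ 1]\<close>)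
  then show ?thesis by (simp add: D_def d_def)
qed

text \<open>The square expands exactly about \<open>w\<close>, and its linear part cancels the one
  in the hypothesis. The slack \<open>s\<close> lets the same computation serve the inexact step,
  where the subgradient inequality holds only approximately.\<close>

lemma tangent_model_strong_convexity:
  fixes R :: "'a::euclidean_space \<Rightarrow> real"
  assumes a: "0 < \<alpha>"
    and "R (x + v) + s \<ge> R (x + w) - (c + w /\<^sub>R \<alpha>) \<bullet> (v - w)"
  shows "tangent_model \<alpha> R c x v + s \<ge> tangent_model \<alpha> R c x w + (norm (v - w))\<^sup>2 / (2 * \<alpha>)"
proof -
  have "(norm v)\<^sup>2 = (norm w)\<^sup>2 + 2 * (w \<bullet> (v - w)) + (norm (v - w))\<^sup>2"
    by (simp add: power2_norm_eq_inner inner_diff_left inner_diff_right inner_commute algebra_simps)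
  then have "(norm v)\<^sup>2 / (2 * \<alpha>) = (norm w)\<^sup>2 / (2 * \<alpha>) + (w /\<^sub>R \<alpha>) \<bullet> (v - w) + (norm (v - w))\<^sup>2 / (2 * \<alpha>)"
    using a by (simp add: field_simps)
  with assms(2) show ?thesis by (simp add: tangent_model_def inner_add_left inner_diff_right)
qed

text \<open>Completing the square: after the shift by \<open>x\<close>, the proximal objective and
  the model differ by the constant \<open>\<alpha> * (norm c)\<^sup>2 / 2\<close>.\<close>

lemma prox_is_arg_min:
  fixes R :: "'a::euclidean_space \<Rightarrow> real"
  assumes a: "0 < \<alpha>" and L: "l-lipschitz_on UNIV R"
  shows "is_arg_min (tangent_model \<alpha> R c x) (\<lambda>v. v \<in> UNIV) (prox \<alpha> R (x - \<alpha> *\<^sub>R c) - x)"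
proof -
  let ?p = "\<lambda>y. R y + (norm (y - (x - \<alpha> *\<^sub>R c)))\<^sup>2 / (2 * \<alpha>)"
  have eq: "?p y = tangent_model \<alpha> R c x (y - x) + \<alpha> * (norm c)\<^sup>2 / 2" for y
  proof -
    have "(norm (y - (x - \<alpha> *\<^sub>R c)))\<^sup>2 = (norm ((y - x) + \<alpha> *\<^sub>R c))\<^sup>2" by (simp add: algebra_simps)
    also have "\<dots> = (norm (y - x))\<^sup>2 + 2 * \<alpha> * (c \<bullet> (y - x)) + \<alpha> * \<alpha> * (norm c)\<^sup>2"
      unfolding power2_norm_eq_inner
      by (simp add: inner_add_left inner_add_right inner_commute algebra_simps)
    finally show ?thesis using a by (simp add: tangent_model_def field_simps)
  qed
  obtain v where v: "is_arg_min (tangent_model \<alpha> R c x) (\<lambda>v. v \<in> UNIV) v"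
    using tangent_model_has_minimizer[OF subspace_UNIV a L] by blast
  have "is_arg_min ?p (\<lambda>_. True) (x + v)" using v by (simp add: is_arg_min_def eq)
  then have "is_arg_min ?p (\<lambda>_. True) (prox \<alpha> R (x - \<alpha> *\<^sub>R c))"
    unfolding prox_def arg_min_def by (rule someI)
  then have "\<not> tangent_model \<alpha> R c x (y - x) < tangent_model \<alpha> R c x (prox \<alpha> R (x - \<alpha> *\<^sub>R c) - x)" for y
    by (simp add: is_arg_min_def eq)
  from this[of "_ + x"] show ?thesis by (simp add: is_arg_min_def)
qed

lemma exact_step_is_arg_min:
  fixes R :: "'a::euclidean_space \<Rightarrow> real"
  assumes "subspace (tangent_space M x)" and "0 < \<alpha>" and "l-lipschitz_on UNIV R"
  shows "is_arg_min (tangent_model \<alpha> R m x) (\<lambda>v. v \<in> tangent_space M x) (exact_step M \<alpha> R m x)"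
  using tangent_model_has_minimizer[OF assms, of m x] unfolding exact_step_def arg_min_def
  by (rule someI_ex)

text \<open>Strong convexity of the model bounds its conjugate from above by a quadratic that touches the
  linear lower bound given by the maximiser, so the conjugate is differentiable there.\<close>

lemma nabla_dual_fun:
  fixes R :: "real^'d \<Rightarrow> real" and B :: "real^'d^'p"
  assumes a: "0 < \<alpha>" and R: "convex_on UNIV R"
    and w: "is_arg_min (tangent_model \<alpha> R (m + transpose B *v l) x) (\<lambda>v. v \<in> UNIV) w"
  shows "nabla (dual_fun \<alpha> R B m x) l = - (B *v w)"
proof (rule nabla_eqI)
  define q where "q = tangent_model \<alpha> R m x"
  define b where "b = (\<lambda>k. - (transpose B *v k))"
  \<comment> \<open>The tilted model is \<open>q\<close> minus the linear functional
    \<open>b l\<close>, so minimality of \<open>w\<close> there makes \<open>b l\<close> a slope of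
    \<open>q\<close> at \<open>w\<close>, with the strong convexity gain on top.\<close>
  have q: "q y \<ge> q w + b l \<bullet> (y - w) + (norm (y - w))\<^sup>2 / (2 * \<alpha>)" for y
    using tangent_model_strong_convexity[OF a, where c = "m + transpose B *v l" and s = 0 and v = y and w = w and R = R and x = x]
      tangent_model_minimizer_variational[OF subspace_UNIV a R w, of y]
    by (simp add: q_def b_def tangent_model_def inner_add_left inner_diff_right)
  have ub: "s \<bullet> y - q y \<le> (s \<bullet> w - q w) + \<alpha> / 2 * (norm (s - b l))\<^sup>2" for s y
  proof -
    have sq: "(norm (d - \<alpha> *\<^sub>R e))\<^sup>2 = (norm d)\<^sup>2 - 2 * \<alpha> * (e \<bullet> d) + \<alpha> * \<alpha> * (norm e)\<^sup>2" for d e :: "real^'d"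
      by (simp add: power2_norm_eq_inner inner_diff_left inner_diff_right inner_commute algebra_simps)
    \<comment> \<open>Young's inequality with the weight \<alpha>, chosen so that the square of
      \<open>y - w\<close> cancels against the one in \<open>q\<close>.\<close>
    have "0 \<le> (norm ((y - w) - \<alpha> *\<^sub>R (s - b l)))\<^sup>2" by simp
    also note sq
    finally have "(s - b l) \<bullet> (y - w) \<le> (norm (y - w))\<^sup>2 / (2 * \<alpha>) + \<alpha> / 2 * (norm (s - b l))\<^sup>2"
      using a by (simp add: field_simps)
    with q[of y] show ?thesis by (simp add: inner_diff_left inner_diff_right)
  qed
  \<comment> \<open>The real supremum in \<open>fenchel_conj\<close> dominates its members only when
    the set is bounded above.\<close>
  have bdd: "bdd_above (range (\<lambda>y. s \<bullet> y - q y))" for s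
    using ub by (intro bdd_aboveI2)
  have up: "fenchel_conj q s \<le> (s \<bullet> w - q w) + \<alpha> / 2 * (norm (s - b l))\<^sup>2" for s
    unfolding fenchel_conj_def by (intro cSUP_least ub) simp
  have lo: "s \<bullet> w - q w \<le> fenchel_conj q s" for s
    unfolding fenchel_conj_def by (intro cSUP_upper bdd) simp
  have at: "fenchel_conj q (b l) = b l \<bullet> w - q w"
    using up[of "b l"] lo[of "b l"] by simp
  have bl: "bounded_linear b"
    unfolding b_def by (intro bounded_linear_minus matrix_vector_mul_bounded_linear)
  obtain C where C: "\<And>k. norm (b k) \<le> norm k * C" and C0: "0 < C"
    using bounded_linear.pos_bounded[OF bl] by blast
  have bw: "b k \<bullet> w = - (k \<bullet> (B *v w))" for k
    by (simp add: b_def dot_lmul_matrix[symmetric])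
  \<comment> \<open>By \<open>bw\<close> the lower bound \<open>lo\<close> is affine in
    \<open>k\<close> with slope \<open>- (B *v w)\<close>, and \<open>up\<close> exceeds it only by
    a quadratic in \<open>k - l\<close>.\<close>
  have err: "\<bar>fenchel_conj q (b k) - fenchel_conj q (b l) - (k - l) \<bullet> (- (B *v w))\<bar>
      \<le> \<alpha> / 2 * C\<^sup>2 * (norm (k - l))\<^sup>2" for k
  proof -
    have "b k - b l = b (k - l)" using bl by (simp add: bounded_linear.linear linear_diff)
    then have "(norm (b k - b l))\<^sup>2 \<le> (norm (k - l) * C)\<^sup>2"
      using C[of "k - l"] by (simp add: power_mono)
    then have "\<alpha> / 2 * (norm (b k - b l))\<^sup>2 \<le> \<alpha> / 2 * C\<^sup>2 * (norm (k - l))\<^sup>2"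
      using a by (simp add: power_mult_distrib mult.commute mult.left_commute)
    with up[of "b k"] lo[of "b k"] at show ?thesis
      by (simp add: bw inner_diff_left)
  qed
  show "GDERIV (dual_fun \<alpha> R B m x) l :> - (B *v w)"
    unfolding gderiv_def has_derivative_at_alt
  proof (intro conjI allI impI)
    fix e :: real assume e: "0 < e"
    define K where "K = \<alpha> / 2 * C\<^sup>2"
    have K: "0 < K" using a C0 by (simp add: K_def)
    show "\<exists>d>0. \<forall>k. norm (k - l) < d \<longrightarrow>
      norm (dual_fun \<alpha> R B m x k - dual_fun \<alpha> R B m x l - (k - l) \<bullet> - (B *v w)) \<le> e * norm (k - l)"
    proof (intro exI[of _ "e / K"] conjI allI impI)
      fix k assume "norm (k - l) < e / K"
      then have "K * norm (k - l) * norm (k - l) \<le> e * norm (k - l)"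
        using K by (intro mult_right_mono) (auto simp: field_simps)
      with err[of k] show "norm (dual_fun \<alpha> R B m x k - dual_fun \<alpha> R B m x l - (k - l) \<bullet> - (B *v w))
          \<le> e * norm (k - l)"
        by (simp add: dual_fun_def q_def b_def K_def power2_eq_square)
    qed (use e K in simp)
  qed (rule bounded_linear_inner_left)
qed

text \<open>A subgradient relative to an affine subspace extends to a full subgradient: separate the
  strict epigraph from the graph of the affine minorant.\<close>

lemma subgradient_extension:
  fixes R :: "'a::euclidean_space \<Rightarrow> real"
  assumes S: "subspace S" and R: "convex_on UNIV R"
    and q: "\<And>v. v \<in> S \<Longrightarrow> R (p + v) \<ge> R p + q \<bullet> v"
  obtains g where "g \<in> subdifferential R p" "\<And>v. v \<in> S \<Longrightarrow> g \<bullet> v = q \<bullet> v"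
proof -
  define E where "E = {z :: 'a \<times> real. R (fst z) < snd z}"
  define G where "G = (\<lambda>v. (p + v, R p + q \<bullet> v)) ` S"
  have "convex E"
    unfolding convex_alt
  proof (intro ballI allI impI)
    fix y z :: "'a \<times> real" and t :: real
    assume y: "y \<in> E" and z: "z \<in> E" and t: "0 \<le> t \<and> t \<le> 1"
    have "R ((1 - t) *\<^sub>R fst y + t *\<^sub>R fst z) \<le> (1 - t) * R (fst y) + t * R (fst z)"
      using convex_onD[OF R, of t "fst y" "fst z"] t by simp
    also have "\<dots> < (1 - t) * snd y + t * snd z"
    proof (cases "t = 0")
      case False
      then have "t * R (fst z) < t * snd z" using z t by (simp add: E_def)
      moreover have "(1 - t) * R (fst y) \<le> (1 - t) * snd y"
        using y t by (intro mult_left_mono) (auto simp: E_def)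
      ultimately show ?thesis by simp
    qed (use y in \<open>simp add: E_def\<close>)
    finally show "(1 - t) *\<^sub>R y + t *\<^sub>R z \<in> E" by (simp add: E_def)
  qed
  moreover have "convex G"
    unfolding convex_alt
  proof (intro ballI allI impI)
    fix y z :: "'a \<times> real" and t :: real
    assume "y \<in> G" and "z \<in> G" and t: "0 \<le> t \<and> t \<le> 1"
    then obtain v v' where v: "v \<in> S" "v' \<in> S" "y = (p + v, R p + q \<bullet> v)" "z = (p + v', R p + q \<bullet> v')"
      by (auto simp: G_def)
    have "(1 - t) *\<^sub>R v + t *\<^sub>R v' \<in> S" by (intro subspace_add subspace_scale S v)
    moreover have "(1 - t) *\<^sub>R y + t *\<^sub>R z = (p + ((1 - t) *\<^sub>R v + t *\<^sub>R v'), R p + q \<bullet> ((1 - t) *\<^sub>R v + t *\<^sub>R v'))"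
      by (simp add: v inner_add_right algebra_simps)
    ultimately show "(1 - t) *\<^sub>R y + t *\<^sub>R z \<in> G" by (auto simp: G_def)
  qed
  moreover have "(p, R p + 1) \<in> E" by (simp add: E_def)
  then have "E \<noteq> {}" by blast
  moreover have "G \<noteq> {}" using subspace_0[OF S] by (auto simp: G_def)
  moreover have "E \<inter> G = {}" using q by (force simp: E_def G_def)
  ultimately obtain A c where A: "A \<noteq> 0" and AE: "\<And>z. z \<in> E \<Longrightarrow> A \<bullet> z \<le> c" and AG: "\<And>z. z \<in> G \<Longrightarrow> A \<bullet> z \<ge> c"
    using separating_hyperplane_sets[of E G] by blast
  obtain a b where ab: "A = (a, b)" by (cases A)
  have E: "a \<bullet> y + b * r \<le> c" if "R y < r" for y r
    using AE[of "(y, r)"] that by (simp add: E_def ab)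
  have G: "c \<le> a \<bullet> (p + v) + b * (R p + q \<bullet> v)" if "v \<in> S" for v
    using AG[of "(p + v, R p + q \<bullet> v)"] that by (simp add: G_def ab)
  \<comment> \<open>Points of the graph of \<open>R\<close> are limits of points of the strict
    epigraph.\<close>
  have Ecl: "a \<bullet> y + b * R y \<le> c" for y
  proof -
    have "((\<lambda>r. a \<bullet> y + b * r) \<longlongrightarrow> a \<bullet> y + b * R y) (at_right (R y))" by (intro tendsto_intros)
    then show ?thesis
      by (rule tendsto_upperbound) (auto simp: eventually_at_right_field intro!: exI[of _ "R y + 1"] E)
  qed
  have c: "c = a \<bullet> p + b * R p" using Ecl[of p] G[OF subspace_0[OF S]] by simp
  \<comment> \<open>The hyperplane is not vertical: with \<open>b = 0\<close> the functional
    \<open>a\<close> would be bounded above on the whole space by its value at \<open>p\<close>, so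
    \<open>a = 0\<close> and then \<open>A = 0\<close>.\<close>
  have b: "b < 0"
  proof (rule ccontr)
    assume "\<not> b < 0"
    moreover have "b * 1 \<le> 0" using E[of p "R p + 1"] c by (simp add: algebra_simps)
    ultimately have b0: "b = 0" by simp
    have "a \<bullet> a \<le> 0" using Ecl[of "p + a"] by (simp add: b0 c inner_add_right)
    then have "a = 0" using inner_ge_zero[of a] by simp
    with A b0 show False by (simp add: ab zero_prod_def)
  qed
  define g where "g = (- 1 / b) *\<^sub>R a"
  have "R p + g \<bullet> (y - p) \<le> R y" for y
    using Ecl[of y] b by (simp add: c g_def inner_diff_right field_simps)
  then have "g \<in> subdifferential R p" by (simp add: subdifferential_def)
  moreover have "g \<bullet> v = q \<bullet> v" if v: "v \<in> S" for v
  proof -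
    have "0 \<le> a \<bullet> v + b * (q \<bullet> v)" using G[OF v] c by (simp add: inner_add_right algebra_simps)
    moreover have "a \<bullet> v + b * (q \<bullet> v) \<le> 0"
      using G[OF subspace_neg[OF S v]] c by (simp add: inner_add_right algebra_simps)
    ultimately have "a \<bullet> v = - b * (q \<bullet> v)" by simp
    then show ?thesis using b by (simp add: g_def)
  qed
  ultimately show ?thesis by (rule that)
qed

text \<open>The slope \<open>g\<close> is a subgradient of \<open>R\<close> at \<open>x + w\<close>,
  and on \<open>S\<close> it agrees with the slope wanted at \<open>\<eta>\<close>, because both
  \<open>b\<close> and \<open>w - \<eta>\<close> are orthogonal to \<open>S\<close>. The Lipschitz
  constant is paid twice: once for moving \<open>R\<close> from \<open>x + w\<close> to
  \<open>x + \<eta>\<close>, once for \<open>g \<bullet> (w - \<eta>)\<close>. This is the factor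
  2.\<close>

lemma inexact_tangent_step:
  fixes R :: "'a::euclidean_space \<Rightarrow> real"
  assumes S: "subspace S" and a: "0 < \<alpha>" and R: "convex_on UNIV R" and L: "l-lipschitz_on UNIV R"
    and w: "is_arg_min (tangent_model \<alpha> R (m + b) x) (\<lambda>v. v \<in> UNIV) w"
    and b: "\<And>v. v \<in> S \<Longrightarrow> b \<bullet> v = 0" and m: "m \<in> S" and v: "v \<in> S"
  defines "\<eta> \<equiv> closest_point S w"
  shows "tangent_model \<alpha> R m x \<eta> + (norm (v - \<eta>))\<^sup>2 / (2 * \<alpha>)
           \<le> tangent_model \<alpha> R m x v + 2 * l * norm (w - \<eta>)"
proof -
  define g where "g = - (m + b + w /\<^sub>R \<alpha>)"
  have g: "R (x + y) \<ge> R (x + w) + g \<bullet> (y - w)" for y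
    using tangent_model_minimizer_variational[OF subspace_UNIV a R w, of y]
    by (simp add: g_def inner_diff_left inner_minus_left inner_add_left)
  have \<eta>: "\<eta> \<in> S" unfolding \<eta>_def by (rule closest_point_subspace_in[OF S])
  have o: "(w - \<eta>) \<bullet> y = 0" if "y \<in> S" for y
    unfolding \<eta>_def by (rule closest_point_subspace_orthogonal[OF S that])
  have "g \<bullet> (w - \<eta>) \<le> l * norm (w - \<eta>)"
    using g[of "w + (w - \<eta>)"] lipschitz_on_real_abs_le[OF L, of "x + (w + (w - \<eta>))" "x + w"] by simp
  moreover have "R (x + \<eta>) - R (x + w) \<le> l * norm (w - \<eta>)"
    using lipschitz_on_real_abs_le[OF L, of "x + \<eta>" "x + w"] by (simp add: norm_minus_commute)
  moreover have "g \<bullet> (v - w) = - (m + \<eta> /\<^sub>R \<alpha>) \<bullet> (v - \<eta>) - g \<bullet> (w - \<eta>)"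
  proof -
    have vS: "v - \<eta> \<in> S" by (intro subspace_diff S v \<eta>)
    have "w \<bullet> (v - \<eta>) = \<eta> \<bullet> (v - \<eta>)" using o[OF vS] by (simp add: inner_diff_left)
    then have "g \<bullet> (v - \<eta>) = - (m + \<eta> /\<^sub>R \<alpha>) \<bullet> (v - \<eta>)"
      using b[OF vS] by (simp only: g_def inner_minus_left inner_add_left inner_scaleR_left)
    then show ?thesis by (simp add: inner_diff_right)
  qed
  ultimately have "R (x + v) + 2 * l * norm (w - \<eta>) \<ge> R (x + \<eta>) - (m + \<eta> /\<^sub>R \<alpha>) \<bullet> (v - \<eta>)"
    using g[of v] by (simp add: inner_diff_left inner_add_left)
  from tangent_model_strong_convexity[OF a this] show ?thesis .
qed

section \<open>Continuity of the Riemannian gradient\<close>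

text \<open>On an open set the local extension \<open>g\<close> from \<open>smooth_on\<close> agrees
  with \<open>\<psi>\<close> near each point, so both have the same derivatives there.\<close>

lemma
  fixes \<psi> :: "'a::real_normed_vector \<Rightarrow> 'b::real_normed_vector"
  assumes S: "smooth_on U \<psi>" and U: "open U"
  shows smooth_on_open_differentiable: "\<And>y. y \<in> U \<Longrightarrow> \<psi> differentiable (at y)"
    and smooth_on_open_continuous_derivative: "continuous_on U (\<lambda>y. frechet_derivative \<psi> (at y) v)"
proof -
  have *: "\<psi> differentiable (at y) \<and> isCont (\<lambda>y. frechet_derivative \<psi> (at y) v) y" if y: "y \<in> U" for y
  proof -
    from S y obtain W g where W: "open W" "y \<in> W" and C: "\<And>k. Ck_on k W g" and eq: "\<And>z. z \<in> U \<inter> W \<Longrightarrow> g z = \<psi> z"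
      unfolding smooth_on_def by metis
    have g: "g differentiable (at z)" if "z \<in> W" for z using C[of "Suc 0"] that by simp
    have cont: "continuous_on W (\<lambda>z. frechet_derivative g (at z) v)" using C[of "Suc 0"] by simp
    have op: "open (U \<inter> W)" using U W by blast
    have der: "(\<psi> has_derivative frechet_derivative g (at z)) (at z)" if z: "z \<in> U \<inter> W" for z
    proof -
      have "(g has_derivative frechet_derivative g (at z)) (at z)"
        using g z frechet_derivative_works by blast
      then show ?thesis by (rule has_derivative_transform_within_open[OF _ op z]) (rule eq)
    qed
    then have fd: "frechet_derivative \<psi> (at z) = frechet_derivative g (at z)" if "z \<in> U \<inter> W" for z
      using frechet_derivative_at that by metis
    have "continuous_on (U \<inter> W) (\<lambda>z. frechet_derivative g (at z) v)"
      by (rule continuous_on_subset[OF cont]) simp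
    then have "continuous_on (U \<inter> W) (\<lambda>z. frechet_derivative \<psi> (at z) v)"
      by (rule continuous_on_cong[THEN iffD1, rotated 2]) (simp_all add: fd)
    then have "isCont (\<lambda>z. frechet_derivative \<psi> (at z) v) y"
      using op y W by (simp add: continuous_on_eq_continuous_at)
    with der[of y] y W show ?thesis by (auto simp: differentiable_def)
  qed
  then show "\<And>y. y \<in> U \<Longrightarrow> \<psi> differentiable (at y)" by blast
  show "continuous_on U (\<lambda>y. frechet_derivative \<psi> (at y) v)"
    using * by (blast intro: continuous_at_imp_continuous_on)
qed

text \<open>Along a curve in \<open>M\<close> the function \<open>\<psi>\<close> vanishes near
  parameter 0; differentiate by the chain rule. The inclusion holds for every chart around the
  point, not only for the selected one.\<close>

lemma tangent_space_subset_kernel: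
  fixes \<psi> :: "real^'d \<Rightarrow> real^'p"
  assumes L: "local_defining M U \<psi>" and x: "x \<in> U" and v: "v \<in> tangent_space M x"
  shows "jacobian \<psi> (at x) *v v = 0"
proof -
  have U: "open U" and S: "smooth_on U \<psi>" and M: "M \<inter> U = {x \<in> U. \<psi> x = 0}"
    using L by (auto simp: local_defining_def)
  from v obtain c e where e: "0 < e" and cM: "c ` {-e<..<e} \<subseteq> M" and c0: "c 0 = x"
    and c: "(c has_vector_derivative v) (at (0::real))"
    unfolding tangent_space_def by blast
  let ?J = "jacobian \<psi> (at x)"
  have d: "(\<psi> has_derivative (\<lambda>v. ?J *v v)) (at x)"
    using smooth_on_open_differentiable[OF S U x] by (simp add: jacobian_works)
  have "((\<psi> \<circ> c) has_derivative (\<lambda>t. ?J *v (t *\<^sub>R v))) (at 0)"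
    using diff_chain_at[OF c[unfolded has_vector_derivative_def], of \<psi> "\<lambda>v. ?J *v v"] d
    by (simp add: c0 o_def)
  moreover have "((\<psi> \<circ> c) has_derivative (\<lambda>t. 0)) (at 0)"
  proof (rule has_derivative_transform_eventually)
    have "isCont c 0" using c has_vector_derivative_continuous by blast
    then have "eventually (\<lambda>t. c t \<in> U) (nhds 0)"
      using U x by (simp add: continuous_at_open c0 eventually_nhds)
    moreover have "eventually (\<lambda>t. t \<in> {-e<..<e}) (nhds 0)"
      using e by (intro eventually_nhds_in_open) auto
    ultimately have *: "eventually (\<lambda>t. 0 = (\<psi> \<circ> c) t) (nhds 0)"
    proof eventually_elim
      case (elim t)
      then have "c t \<in> M \<inter> U" using cM by blast
      then show ?case using M by simp
    qed
    then show "eventually (\<lambda>t. 0 = (\<psi> \<circ> c) t) (at 0)"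
      unfolding eventually_at_filter by (rule eventually_mono) simp
    show "0 = (\<psi> \<circ> c) 0" by (rule eventually_nhds_x_imp_x[OF *])
  qed (rule has_derivative_const, simp)
  ultimately have "(\<lambda>t. ?J *v (t *\<^sub>R v)) = (\<lambda>t. 0)"
    by (rule has_derivative_unique)
  then have "?J *v (1 *\<^sub>R v) = 0" by metis
  then show ?thesis by simp
qed

text \<open>Kernels are orthogonal complements of row spaces, so the inclusion reverses between row
  spaces, where equal dimension forces equality.\<close>

lemma kernel_eq_if_subset_and_full_rank:
  fixes A A' :: "real^'d^'p"
  assumes sub: "{v. A *v v = 0} \<subseteq> {v. A' *v v = 0}" and r: "rank A = rank A'"
  shows "{v. A *v v = 0} = {v. A' *v v = 0}"
proof -
  have ker: "{v. C *v v = 0} = orthogonal_comp (range ((*v) (transpose C)))" for C :: "real^'d^'p"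
    using ker_orthogonal_comp_adjoint[of "(*v) C"] by (simp add: adjoint_matrix vimage_def)
  have S: "subspace (range ((*v) (transpose C)))" for C :: "real^'d^'p"
    by (intro linear_subspace_image subspace_UNIV matrix_vector_mul_linear)
  have "orthogonal_comp (orthogonal_comp (range ((*v) (transpose A'))))
      \<subseteq> orthogonal_comp (orthogonal_comp (range ((*v) (transpose A))))"
    using orthogonal_comp_anti_mono[OF sub[unfolded ker]] .
  then have "range ((*v) (transpose A')) \<subseteq> range ((*v) (transpose A))"
    by (simp only: orthogonal_comp_self[OF S])
  moreover have "dim (range ((*v) (transpose A))) \<le> dim (range ((*v) (transpose A')))"
    unfolding rank_dim_range[symmetric] rank_transpose using r by simp
  ultimately have "range ((*v) (transpose A')) = range ((*v) (transpose A))"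
    using subspace_dim_equal[OF S S] by blast
  then show ?thesis by (simp add: ker)
qed

text \<open>The quadratic form of the Gram matrix at \<open>k\<close> is the squared norm of
  \<open>transpose A *v k\<close>, which vanishes only at 0 when the rows are independent.\<close>

lemma gram_matrix_det_nonzero:
  fixes A :: "real^'d^'p"
  assumes "rank A = CARD('p)"
  shows "det (A ** transpose A) \<noteq> 0"
proof -
  have inj: "inj ((*v) (transpose A))"
    using assms by (simp add: full_rank_injective[symmetric] rank_transpose)
  have "k = 0" if "(A ** transpose A) *v k = 0" for k
  proof -
    have "(transpose A *v k) \<bullet> (transpose A *v k) = k \<bullet> ((A ** transpose A) *v k)"
      by (simp add: dot_lmul_matrix matrix_vector_mul_assoc[symmetric])
    then have "transpose A *v k = 0" using that by simp
    then show ?thesis using injD[OF inj, of k 0] by simp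
  qed
  then have "invertible (A ** transpose A)"
    by (metis invertible_left_inverse matrix_left_invertible_ker)
  then show ?thesis by (simp add: invertible_det_nz)
qed

text \<open>Cramer's rule for the normal equations \<open>(A ** transpose A) *v k = A *v v\<close>.
  A quotient of determinants makes continuity in \<open>A\<close> and \<open>v\<close>
  evident.\<close>

definition gram_solve :: "real^'d^'p \<Rightarrow> real^'d \<Rightarrow> real^'p" where
  "gram_solve A v = (\<chi> k. det (\<chi> i j. if j = k then (A *v v)$i else (A ** transpose A)$i$j) / det (A ** transpose A))"

text \<open>The subtracted vector lies in the row space, hence is orthogonal to the kernel; the
  normal equations put the remainder into the kernel.\<close>

lemma closest_point_kernel:
  fixes A :: "real^'d^'p"
  assumes "rank A = CARD('p)"
  shows "closest_point {z. A *v z = 0} v = v - transpose A *v gram_solve A v"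
proof (rule closest_point_subspace_eqI)
  have "(A ** transpose A) *v gram_solve A v = A *v v"
    using cramer[OF gram_matrix_det_nonzero[OF assms]] by (simp add: gram_solve_def)
  then show "v - transpose A *v gram_solve A v \<in> {z. A *v z = 0}"
    by (simp add: matrix_vector_mult_diff_distrib matrix_vector_mul_assoc del: transpose_matrix_vector)
  show "subspace {z. A *v z = 0}"
    by (rule linear_subspace_kernel) simp
  show "(v - (v - transpose A *v gram_solve A v)) \<bullet> z = 0" if "z \<in> {z. A *v z = 0}" for z
    using that by (simp add: dot_lmul_matrix)
qed

lemma continuous_on_closest_point_kernel:
  fixes A :: "'a::topological_space \<Rightarrow> real^'d^'p"
  assumes A: "\<And>i j. continuous_on S (\<lambda>y. A y $ i $ j)" and v: "continuous_on S v"
    and r: "\<And>y. y \<in> S \<Longrightarrow> rank (A y) = CARD('p)"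
  shows "continuous_on S (\<lambda>y. closest_point {z. A y *v z = 0} (v y))"
proof -
  have det: "continuous_on S (\<lambda>y. det (C y))"
    if "\<And>i j. continuous_on S (\<lambda>y. C y $ i $ j)" for C :: "'a \<Rightarrow> real^'p^'p"
    unfolding det_def using that by (intro continuous_on_sum continuous_on_mult continuous_on_const continuous_on_prod)
  have Av: "continuous_on S (\<lambda>y. (A y *v v y) $ i)" for i
    unfolding matrix_vector_mult_def vec_lambda_beta
    by (intro continuous_on_sum continuous_on_mult A continuous_on_component v)
  have AA: "continuous_on S (\<lambda>y. (A y ** transpose (A y)) $ i $ j)" for i j
    unfolding matrix_matrix_mult_def transpose_def vec_lambda_beta
    by (intro continuous_on_sum continuous_on_mult A)
  have ent: "continuous_on S (\<lambda>y. if j = k then (A y *v v y) $ i else (A y ** transpose (A y)) $ i $ j)"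
    for i j k using Av AA by (cases "j = k") simp_all
  have g: "continuous_on S (\<lambda>y. gram_solve (A y) (v y) $ k)" for k
    unfolding gram_solve_def vec_lambda_beta
    using gram_matrix_det_nonzero[OF r]
    by (intro continuous_on_divide det) (simp_all add: ent AA)
  have "continuous_on S (\<lambda>y. v y - transpose (A y) *v gram_solve (A y) (v y))"
    unfolding matrix_vector_mult_def transpose_def vec_lambda_beta
    by (intro continuous_on_diff v continuous_on_vec_lambda continuous_on_sum continuous_on_mult A g)
  then show ?thesis
    by (rule continuous_on_cong[THEN iffD1, rotated 2]) (simp_all add: closest_point_kernel r)
qed

text \<open>The chart selection need not be measurable. Near a point of \<open>V l\<close> the tangent spaces are the
  kernels of the Jacobians of the single function \<open>\<psi> l\<close>, so the projection depends continuously on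
  the base point.\<close>

lemma continuous_on_riem_grad:
  fixes M :: "(real^'d) set" and \<psi> :: "nat \<Rightarrow> real^'d \<Rightarrow> real^'p"
  assumes cover: "defining_cover M I V U \<psi>"
    and sel: "\<And>y. y \<in> M \<Longrightarrow> sel y \<in> I \<and> y \<in> V (sel y)"
    and ker: "\<And>y. y \<in> M \<Longrightarrow> {v. jacobian (\<psi> (sel y)) (at y) *v v = 0} = tangent_space M y"
    and h: "continuous_on M (nabla h)"
  shows "continuous_on M (riem_grad M h)"
proof -
  have V: "open (V l)" "V l \<subseteq> U l" "local_defining M (U l) (\<psi> l)" if "l \<in> I" for l
    using cover that closure_subset[of "V l"] by (auto simp: defining_cover_def)
  have rank: "rank (jacobian (\<psi> l) (at y)) = CARD('p)" if "l \<in> I" "y \<in> V l" "y \<in> M" for l y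
    using V[OF that(1)] that by (auto simp: local_defining_def)
  \<comment> \<open>The assumption \<open>ker\<close> identifies the tangent space only through the
    selected chart. For another chart \<open>l\<close> the curves give one inclusion and the common
    rank gives equality.\<close>
  have T: "tangent_space M y = {v. jacobian (\<psi> l) (at y) *v v = 0}" if l: "l \<in> I" "y \<in> V l" and y: "y \<in> M" for l y
  proof -
    have "{v. jacobian (\<psi> (sel y)) (at y) *v v = 0} \<subseteq> {v. jacobian (\<psi> l) (at y) *v v = 0}"
      using tangent_space_subset_kernel[OF V(3)[OF l(1)], of y] V(2) l y ker[OF y] by auto
    then show ?thesis
      using kernel_eq_if_subset_and_full_rank rank sel[OF y] l y ker[OF y] by metis
  qed
  have "continuous_on (M \<inter> V l) (riem_grad M h)" if l: "l \<in> I" for l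
  proof -
    have U: "open (U l)" "smooth_on (U l) (\<psi> l)" using V(3)[OF l] by (auto simp: local_defining_def)
    have "continuous_on (M \<inter> V l) (\<lambda>y. jacobian (\<psi> l) (at y) $ i $ j)" for i j
    proof -
      have "continuous_on (U l) (\<lambda>y. frechet_derivative (\<psi> l) (at y) (axis j 1) $ i)"
        by (intro continuous_on_component smooth_on_open_continuous_derivative U)
      then show ?thesis
        unfolding jacobian_def matrix_def using V(2)[OF l]
        by (auto elim!: continuous_on_subset)
    qed
    moreover have "continuous_on (M \<inter> V l) (nabla h)" by (rule continuous_on_subset[OF h]) simp
    ultimately have "continuous_on (M \<inter> V l) (\<lambda>y. closest_point {z. jacobian (\<psi> l) (at y) *v z = 0} (nabla h y))"
      by (rule continuous_on_closest_point_kernel) (use rank l in auto)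
    then show ?thesis
      by (rule continuous_on_cong[THEN iffD1, rotated 2]) (use l in \<open>simp_all add: riem_grad_def T\<close>)
  qed
  \<comment> \<open>Each \<open>V l\<close> is open, so continuity relative to
    \<open>M \<inter> V l\<close> is continuity relative to \<open>M\<close> at its points.\<close>
  then have "continuous (at y within (M \<inter> V (sel y))) (riem_grad M h)" if "y \<in> M" for y
    using sel[OF that] that by (auto simp: continuous_on_eq_continuous_within)
  moreover have "at y within M = at y within (M \<inter> V (sel y))" if "y \<in> M" for y
    using sel[OF that] V(1) by (intro at_within_nhd[of y "V (sel y)"]) auto
  ultimately show ?thesis by (auto simp: continuous_on_eq_continuous_within)
qed

section \<open>One step of the iteration\<close>

text \<open>The origin of \<open>C\<^sub>\<alpha>\<close>: squaring the condition on \<alpha> gives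
  \<open>b * \<alpha> + 2 * sqrt \<alpha> * sqrt a < d\<close>, and the left side is at least the
  larger root of the quadratic in \<open>t\<close>. It is used with
  \<open>a = l\<^sub>R * C\<^sub>0 * \<Delta>bar\<close> and
  \<open>b = M\<^sub>u + l\<^sub>R\<close>.\<close>

lemma stepsize_quadratic_bound:
  fixes a b d \<alpha> t :: real
  assumes a: "0 \<le> a" and b: "0 < b" and d: "0 < d" and \<alpha>: "0 < \<alpha>"
    and C: "\<alpha> < ((sqrt (a + b * d) - sqrt a) / b)\<^sup>2"
    and t: "t\<^sup>2 \<le> \<alpha> * b * t + 2 * \<alpha> * a"
  shows "t \<le> d"
proof (rule ccontr)
  assume "\<not> t \<le> d"
  then have td: "d < t" by simp
  have "sqrt \<alpha> < sqrt (((sqrt (a + b * d) - sqrt a) / b)\<^sup>2)" using C by (rule real_sqrt_less_mono)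
  also have "\<dots> = (sqrt (a + b * d) - sqrt a) / b" using b d by (simp add: abs_of_nonneg)
  finally have "b * sqrt \<alpha> + sqrt a < sqrt (a + b * d)" using b by (simp add: field_simps)
  then have "(b * sqrt \<alpha> + sqrt a)\<^sup>2 < (sqrt (a + b * d))\<^sup>2"
    using a b \<alpha> by (intro power_strict_mono) auto
  moreover have "(b * sqrt \<alpha> + sqrt a)\<^sup>2 = b * (b * \<alpha> + 2 * (sqrt \<alpha> * sqrt a)) + a"
    using a \<alpha> by (simp add: power2_sum power_mult_distrib) (simp add: algebra_simps power2_eq_square)
  ultimately have "b * (b * \<alpha> + 2 * (sqrt \<alpha> * sqrt a)) < b * d" using a b d by simp
  then have lt: "b * \<alpha> + 2 * (sqrt \<alpha> * sqrt a) < t" using b td by simp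
  define q where "q = sqrt \<alpha> * sqrt a"
  have q: "0 \<le> q" "q * q = \<alpha> * a"
    using a \<alpha> by (simp_all add: q_def mult.left_commute mult.commute real_sqrt_mult[symmetric])
  have "2 * q \<le> t" using lt b \<alpha> by (simp add: q_def) (smt (verit) mult_pos_pos)
  then have "q * (2 * q) \<le> q * t" using q by (intro mult_left_mono)
  moreover have "(b * \<alpha> + 2 * q) * t < t * t" using lt d td by (intro mult_strict_right_mono) (auto simp: q_def)
  moreover have "0 \<le> \<alpha> * a" using a \<alpha> by simp
  ultimately show False using t q by (simp add: power2_eq_square algebra_simps)
qed

text \<open>The square occurs once inside the model and once as strong convexity gain, together
  \<open>(norm v)\<^sup>2 / \<alpha>\<close>; the remaining terms of the model fall below
  \<open>R x\<close> by at most \<open>(Mu + l) * norm v\<close>.\<close>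

lemma tangent_step_quadratic:
  fixes R :: "'a::euclidean_space \<Rightarrow> real"
  assumes a: "0 < \<alpha>" and L: "l-lipschitz_on UNIV R" and m: "norm m \<le> Mu"
    and step: "tangent_model \<alpha> R m x v + (norm v)\<^sup>2 / (2 * \<alpha>) \<le> R x + e"
  shows "(norm v)\<^sup>2 \<le> \<alpha> * (Mu + l) * norm v + \<alpha> * e"
proof -
  have "- (Mu * norm v) \<le> m \<bullet> v"
    using Cauchy_Schwarz_ineq2[of m v] mult_right_mono[OF m norm_ge_zero[of v]] by simp
  moreover have "R x - R (x + v) \<le> l * norm v"
    using lipschitz_on_real_abs_le[OF L, of x "x + v"] by simp
  ultimately have "(norm v)\<^sup>2 / \<alpha> \<le> (Mu + l) * norm v + e"
    using step by (simp add: tangent_model_def algebra_simps)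
  then show ?thesis using a by (simp add: field_simps)
qed

text \<open>Convexity compares the model at \<open>t *\<^sub>R v\<close> with its value at \<open>v\<close>, and the gradient error is
  absorbed by Young's inequality with weight \<open>\<tau>\<close>.\<close>

lemma retraction_step_descent:
  fixes R :: "'a::euclidean_space \<Rightarrow> real"
  assumes R: "convex_on UNIV R" and t: "0 \<le> t" "t \<le> 1" and \<tau>: "0 < \<tau>" and L: "0 \<le> LF" "0 \<le> LR" and e: "0 \<le> e"
    and F: "F1 - F0 - g \<bullet> (t *\<^sub>R v) \<le> LF / 2 * (norm (t *\<^sub>R v))\<^sup>2"
    and R1: "R1 - R (x + t *\<^sub>R v) \<le> LR * (norm (t *\<^sub>R v))\<^sup>2"
    and model: "tangent_model \<alpha> R m x v \<le> R x - (norm vh)\<^sup>2 / (2 * \<alpha>) + e"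
  shows "F1 + R1 \<le> F0 + R x - t * (1 / (2 * \<alpha>) - LF / 2 - LR - \<tau> / 2) * (norm v)\<^sup>2
           - t / (2 * \<alpha>) * (norm vh)\<^sup>2 + e + (norm (m - g))\<^sup>2 / (2 * \<tau>)"
proof -
  define N where "N = (norm v)\<^sup>2"
  define E where "E = (norm (m - g))\<^sup>2"
  have R2: "R (x + t *\<^sub>R v) \<le> (1 - t) * R x + t * R (x + v)"
  proof -
    have "x + t *\<^sub>R v = (1 - t) *\<^sub>R x + t *\<^sub>R (x + v)" by (simp add: algebra_simps)
    then show ?thesis using convex_onD[OF R, of t x "x + v"] t by simp
  qed
  \<comment> \<open>The retraction errors are quadratic in \<open>t *\<^sub>R v\<close>; this
    charges them linearly in \<open>t\<close>, like the gain from the model.\<close>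
  have tt: "t * t \<le> t" using t mult_right_mono[of t 1 t] by simp
  have N: "0 \<le> N" by (simp add: N_def)
  have sq: "(norm (t *\<^sub>R v))\<^sup>2 = t * t * N"
    by (simp add: N_def power_mult_distrib power2_eq_square)
  have "(LF / 2 + LR) * (t * t * N) \<le> (LF / 2 + LR) * (t * N)"
    using L N tt by (intro mult_left_mono mult_right_mono) auto
  moreover have "t * (tangent_model \<alpha> R m x v) \<le> t * (R x - (norm vh)\<^sup>2 / (2 * \<alpha>) + e)"
    using model t by (intro mult_left_mono)
  moreover have "t * e \<le> e" using t e by (simp add: mult_left_le_one_le)
  moreover have "t * (- ((m - g) \<bullet> v)) \<le> t * (\<tau> / 2 * N) + E / (2 * \<tau>)"
  proof -
    have "0 \<le> (norm ((m - g) + \<tau> *\<^sub>R v))\<^sup>2" by simp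
    also have "\<dots> = E + 2 * \<tau> * ((m - g) \<bullet> v) + \<tau> * \<tau> * N"
      unfolding E_def N_def power2_norm_eq_inner
      by (simp add: inner_add_left inner_add_right inner_commute algebra_simps)
    finally have "- ((m - g) \<bullet> v) \<le> \<tau> / 2 * N + E / (2 * \<tau>)"
      using \<tau> by (simp add: field_simps)
    then have "t * (- ((m - g) \<bullet> v)) \<le> t * (\<tau> / 2 * N + E / (2 * \<tau>))"
      using t by (intro mult_left_mono)
    moreover have "t * (E / (2 * \<tau>)) \<le> E / (2 * \<tau>)"
      using t \<tau> by (intro mult_left_le_one_le) (auto simp: E_def)
    ultimately show ?thesis by (simp add: distrib_left)
  qed
  ultimately show ?thesis
    using F R1 R2 unfolding sq tangent_model_def N_def[symmetric] E_def[symmetric]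
    by (simp add: inner_diff_left algebra_simps)
qed

text \<open>Optimality of \<open>v\<close> yields a subgradient \<open>g\<close> that equals
  \<open>q\<close> on the tangent space; whatever separates it from the desired residual is normal
  and is absorbed by \<open>n\<close>. This single element bounds the infimal distance.\<close>

lemma Theta_square_le:
  fixes R :: "'a::euclidean_space \<Rightarrow> real"
  assumes S: "subspace (tangent_space M x)" and a: "0 < \<alpha>" and R: "convex_on UNIV R"
    and v: "is_arg_min (tangent_model \<alpha> R m x) (\<lambda>v. v \<in> tangent_space M x) v"
    and lf: "0 \<le> l" "norm (nabla F (x + v) - nabla F x) \<le> l * norm v"
  shows "(Theta F R M x v)\<^sup>2 \<le> (1 + 2 * (l + 1 / \<alpha>)\<^sup>2) * (norm v)\<^sup>2 + 2 * (norm (m - riem_grad M F x))\<^sup>2"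
proof -
  define T where "T = tangent_space M x"
  define q where "q = - (m + v /\<^sub>R \<alpha>)"
  define err where "err = m - riem_grad M F x"
  have vT: "v \<in> T" using v by (simp add: is_arg_min_def T_def)
  have "R (x + v + y) \<ge> R (x + v) + q \<bullet> y" if "y \<in> T" for y
    using tangent_model_minimizer_variational[OF S a R v, of "v + y"] that vT subspace_add[OF S]
    by (simp add: q_def T_def inner_add_left inner_diff_left inner_minus_left add.assoc)
  then obtain g where g: "g \<in> subdifferential R (x + v)" and gq: "\<And>y. y \<in> T \<Longrightarrow> g \<bullet> y = q \<bullet> y"
    using subgradient_extension[OF S R, of "x + v" q] unfolding T_def by blast
  \<comment> \<open>Both summands are orthogonal to \<open>T\<close>: a projection residual, and a
    difference of functionals that agree on \<open>T\<close>. With this choice \<open>g\<close>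
    cancels in the sum and only differences of gradients, \<open>v /\<^sub>R \<alpha>\<close> and
    the error remain.\<close>
  define n where "n = (riem_grad M F x - nabla F x) + (q - g)"
  have "n \<bullet> y = 0" if "y \<in> T" for y
    using closest_point_subspace_orthogonal[OF S, of y "nabla F x"] gq that
    by (simp add: n_def riem_grad_def T_def inner_add_left inner_diff_left)
  then have n: "n \<in> normal_space M x"
    by (simp add: normal_space_def orthogonal_comp_def orthogonal_def T_def inner_commute)
  let ?G = "{nabla F (x + v) + g + w | g w. g \<in> subdifferential R (x + v) \<and> w \<in> normal_space M x}"
  have eq: "nabla F (x + v) + g + n = (nabla F (x + v) - nabla F x) - v /\<^sub>R \<alpha> - err"
    by (simp add: n_def q_def err_def)
  have "infdist 0 ?G \<le> norm (nabla F (x + v) + g + n)"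
    using infdist_le[of "nabla F (x + v) + g + n" ?G 0] g n by auto
  also have "\<dots> \<le> norm (nabla F (x + v) - nabla F x) + norm (v /\<^sub>R \<alpha>) + norm err"
    unfolding eq by (meson norm_triangle_ineq4 add_right_mono order_trans)
  also have "\<dots> \<le> (l + 1 / \<alpha>) * norm v + norm err"
    using lf a by (simp add: algebra_simps divide_inverse)
  finally have "(infdist 0 ?G)\<^sup>2 \<le> ((l + 1 / \<alpha>) * norm v + norm err)\<^sup>2"
    by (intro power_mono infdist_nonneg)
  also have "\<dots> \<le> 2 * ((l + 1 / \<alpha>) * norm v)\<^sup>2 + 2 * (norm err)\<^sup>2"
    using sum_squares_bound[of "(l + 1 / \<alpha>) * norm v" "norm err"] by (simp add: power2_sum)
  finally have "(infdist 0 ?G)\<^sup>2 \<le> 2 * (l + 1 / \<alpha>)\<^sup>2 * (norm v)\<^sup>2 + 2 * (norm err)\<^sup>2"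
    by (simp only: power_mult_distrib mult.assoc)
  then show ?thesis
    by (simp add: Theta_def err_def distrib_right)
qed

lemma
  fixes f :: "nat \<Rightarrow> 'a::euclidean_space \<Rightarrow> real"
  assumes n: "1 \<le> n" and C: "\<And>j. j \<in> {1..n} \<Longrightarrow> C1_fun (f j)"
  defines "F \<equiv> \<lambda>y. (\<Sum>j=1..n. f j y) / real n"
  shows continuous_on_average: "continuous_on S F"
    and continuous_on_nabla_average: "continuous_on S (nabla F)"
    and lipschitz_nabla_average:
      "\<lbrakk>\<And>j. j \<in> {1..n} \<Longrightarrow> l-lipschitz_on U (nabla (f j)); y \<in> U; z \<in> U\<rbrakk>
        \<Longrightarrow> norm (nabla F y - nabla F z) \<le> l * norm (y - z)"
    and norm_nabla_average_le: "(\<And>j. j \<in> {1..n} \<Longrightarrow> norm (nabla (f j) y) \<le> c) \<Longrightarrow> norm (nabla F y) \<le> c"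
proof -
  have dF: "(F has_derivative (\<lambda>v. v \<bullet> ((\<Sum>j=1..n. nabla (f j) z) /\<^sub>R real n))) (at z)" for z
  proof -
    have "(f j has_derivative (\<lambda>v. v \<bullet> nabla (f j) z)) (at z)" if "j \<in> {1..n}" for j
      using C[OF that] differentiable_imp_GDERIV unfolding C1_fun_def gderiv_def by blast
    then have "((\<lambda>y. (\<Sum>j=1..n. f j y) /\<^sub>R real n) has_derivative (\<lambda>v. (\<Sum>j=1..n. v \<bullet> nabla (f j) z) /\<^sub>R real n)) (at z)"
      by (intro has_derivative_scaleR_right has_derivative_sum)
    then show ?thesis
      by (simp add: F_def divide_inverse inner_sum_right mult.commute)
  qed
  then have nF: "nabla F z = (\<Sum>j=1..n. nabla (f j) z) /\<^sub>R real n" for z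
    by (intro nabla_eqI) (simp add: gderiv_def)
  show "continuous_on S F"
    by (intro continuous_at_imp_continuous_on ballI has_derivative_continuous[OF dF])
  have "continuous_on S (nabla (f j))" if "j \<in> {1..n}" for j
    using C[OF that] continuous_on_subset unfolding C1_fun_def by blast
  then show "continuous_on S (nabla F)"
    unfolding nF[abs_def] by (intro continuous_intros)
  have scale: "inverse (real n) * a \<le> b" if "a \<le> real n * b" for a b
    using n that by (simp add: field_simps)
  show "norm (nabla F y - nabla F z) \<le> l * norm (y - z)"
    if lip: "\<And>j. j \<in> {1..n} \<Longrightarrow> l-lipschitz_on U (nabla (f j))" and yz: "y \<in> U" "z \<in> U"
  proof -
    have "norm (\<Sum>j=1..n. nabla (f j) y - nabla (f j) z) \<le> (\<Sum>j=1..n. l * norm (y - z))"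
      using lipschitz_onD[OF lip _ ] yz by (intro sum_norm_le) (auto simp: dist_norm)
    moreover have "nabla F y - nabla F z = (\<Sum>j=1..n. nabla (f j) y - nabla (f j) z) /\<^sub>R real n"
      by (simp only: nF sum_subtractf scaleR_diff_right)
    ultimately show ?thesis
      using scale by simp
  qed
  show "norm (nabla F y) \<le> c" if "\<And>j. j \<in> {1..n} \<Longrightarrow> norm (nabla (f j) y) \<le> c"
  proof -
    have "norm (\<Sum>j=1..n. nabla (f j) y) \<le> (\<Sum>j=1..n. c)"
      using that by (intro sum_norm_le)
    then show ?thesis using scale by (simp add: nF)
  qed
qed

text \<open>Approximate minimality of \<open>\<eta>\<close> is tested at two points: at 0 it bounds
  \<open>norm \<eta>\<close>, at the exact step \<open>v\<close> it bounds the model value. The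
  squared norm of \<open>v\<close> in the last claim is the gain of \<open>v\<close> over 0.\<close>

lemma iteration_step:
  fixes R :: "real^'d \<Rightarrow> real" and B :: "real^'d^'p"
  assumes ker: "{v. B *v v = 0} = tangent_space M x"
    and C0: "0 < C0" "\<And>v. infdist v (tangent_space M x) \<le> C0 * norm (B *v v)"
    and R: "convex_on UNIV R" and L: "l-lipschitz_on UNIV R" and a: "0 < \<alpha>" and d: "0 < d"
    and Mu: "0 < Mu" and \<alpha>: "\<alpha> < ((sqrt (l * C0 * \<Delta>bar + (Mu + l) * d) - sqrt (l * C0 * \<Delta>bar)) / (Mu + l))\<^sup>2"
    and \<Delta>: "0 \<le> \<Delta>" "\<Delta> \<le> \<Delta>bar"
    and m: "m \<in> tangent_space M x" "norm m \<le> Mu"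
    and lam: "norm (nabla (dual_fun \<alpha> R B m x) lam) \<le> \<Delta>"
    and w: "w = prox \<alpha> R (x - \<alpha> *\<^sub>R (m + transpose B *v lam)) - x"
  defines "\<eta> \<equiv> proj_tangent M x w" and "v \<equiv> exact_step M \<alpha> R m x"
  shows "\<eta> \<in> tangent_space M x" "norm \<eta> \<le> d"
    and "is_arg_min (tangent_model \<alpha> R m x) (\<lambda>v. v \<in> tangent_space M x) v" "norm v \<le> d"
    and "tangent_model \<alpha> R m x \<eta> \<le> R x - (norm v)\<^sup>2 / (2 * \<alpha>) + 2 * (l * C0) * \<Delta>"
proof -
  let ?T = "tangent_space M x"
  have T: "subspace ?T" unfolding ker[symmetric] by (rule linear_subspace_kernel) simp
  have l: "0 \<le> l" using L by (rule lipschitz_on_nonneg)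
  have w_min: "is_arg_min (tangent_model \<alpha> R (m + transpose B *v lam) x) (\<lambda>v. v \<in> UNIV) w"
    unfolding w by (rule prox_is_arg_min[OF a L])
  have "norm (B *v w) \<le> \<Delta>" using lam nabla_dual_fun[OF a R w_min] by simp
  have "norm (w - \<eta>) \<le> C0 * \<Delta>"
  proof -
    have "infdist w ?T = dist w \<eta>"
      using subspace_0[OF T] setdist_closest_point[OF closed_subspace[OF T], of w]
      by (auto simp: \<eta>_def infdist_eq_setdist)
    then show ?thesis
      using C0(2)[of w] mult_left_mono[OF \<open>norm (B *v w) \<le> \<Delta>\<close> less_imp_le[OF C0(1)]]
      unfolding dist_norm by linarith
  qed
  then have dist: "2 * l * norm (w - \<eta>) \<le> 2 * (l * C0) * \<Delta>"
    using l mult_left_mono[of "norm (w - \<eta>)" "C0 * \<Delta>" "2 * l"] by (simp add: mult.assoc)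
  have perp: "(transpose B *v lam) \<bullet> z = 0" if "z \<in> ?T" for z
    using that by (simp add: ker[symmetric] dot_lmul_matrix)
  have step: "tangent_model \<alpha> R m x \<eta> + (norm (y - \<eta>))\<^sup>2 / (2 * \<alpha>) \<le> tangent_model \<alpha> R m x y + 2 * (l * C0) * \<Delta>"
    if "y \<in> ?T" for y
    using inexact_tangent_step[OF T a R L w_min perp m(1) that] dist
    unfolding \<eta>_def[symmetric] by linarith
  show "\<eta> \<in> ?T" unfolding \<eta>_def by (rule closest_point_subspace_in[OF T])
  \<comment> \<open>One size bound for both steps: \<open>e\<close> is the tolerance term for
    \<open>\<eta>\<close> and 0 for the exact step.\<close>
  have bound: "norm y \<le> d"
    if "tangent_model \<alpha> R m x y + (norm y)\<^sup>2 / (2 * \<alpha>) \<le> R x + e" and e: "e \<le> 2 * (l * C0) * \<Delta>bar" for y e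
  proof (rule stepsize_quadratic_bound[OF _ _ d a \<alpha>])
    have "\<alpha> * e \<le> \<alpha> * (2 * (l * C0) * \<Delta>bar)" using e a by (intro mult_left_mono) auto
    with tangent_step_quadratic[OF a L m(2) that(1)]
    show "(norm y)\<^sup>2 \<le> \<alpha> * (Mu + l) * norm y + 2 * \<alpha> * (l * C0 * \<Delta>bar)" by simp
  qed (use l C0 \<Delta> Mu in auto)
  have lC: "0 \<le> l * C0" using l C0 by simp
  have T0: "tangent_model \<alpha> R m x 0 = R x" by (simp add: tangent_model_def)
  show "norm \<eta> \<le> d"
    using step[OF subspace_0[OF T]] mult_left_mono[OF \<Delta>(2), of "2 * (l * C0)"] lC
    by (intro bound[of \<eta> "2 * (l * C0) * \<Delta>"]) (auto simp: T0)
  show v: "is_arg_min (tangent_model \<alpha> R m x) (\<lambda>v. v \<in> ?T) v"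
    unfolding v_def by (rule exact_step_is_arg_min[OF T a L])
  then have vT: "v \<in> ?T" by (simp add: is_arg_min_def)
  have "tangent_model \<alpha> R m x v + (norm (0 - v))\<^sup>2 / (2 * \<alpha>) \<le> tangent_model \<alpha> R m x 0 + 0"
    using tangent_model_minimizer_variational[OF T a R v subspace_0[OF T]]
    by (intro tangent_model_strong_convexity[OF a]) simp
  then have v0: "tangent_model \<alpha> R m x v + (norm v)\<^sup>2 / (2 * \<alpha>) \<le> R x + 0" by (simp add: T0)
  then show "norm v \<le> d" using lC \<Delta> by (intro bound[of v 0]) auto
  have "0 \<le> (norm (v - \<eta>))\<^sup>2 / (2 * \<alpha>)" using a by simp
  with step[OF vT] v0
  show "tangent_model \<alpha> R m x \<eta> \<le> R x - (norm v)\<^sup>2 / (2 * \<alpha>) + 2 * (l * C0) * \<Delta>" by linarith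
qed

section \<open>Expectations and iteration counts\<close>

text \<open>Integrability must come before the inequality can be integrated: if \<open>Er k\<close>
  is integrable, dissipation bounds the conditional expectation of \<open>Er (Suc k)\<close> by an
  integrable function, and both have the same total integral.\<close>

lemma error_dissipation_expectation:
  fixes err \<eta> :: "nat \<Rightarrow> 'w \<Rightarrow> 'a::euclidean_space"
  assumes "prob_space P" and sub: "\<And>k. subalgebra P (Fl k)"
    and ed: "error_dissipation P Fl c \<mu> \<nu> Er err \<eta>"
    and err: "\<And>k. integrable P (\<lambda>\<omega>. (norm (err k \<omega>))\<^sup>2)"
    and \<eta>: "\<And>k. integrable P (\<lambda>\<omega>. (norm (\<eta> k \<omega>))\<^sup>2)"
  shows "integrable P (Er k)"
    and "(\<integral>\<omega>. (norm (err k \<omega>))\<^sup>2 \<partial>P)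
      \<le> c * ((\<integral>\<omega>. Er k \<omega> \<partial>P) - (\<integral>\<omega>. Er (Suc k) \<omega> \<partial>P)) + \<nu> * (\<integral>\<omega>. (norm (\<eta> k \<omega>))\<^sup>2 \<partial>P)"
proof -
  interpret prob_space P by fact
  have pos: "0 < c" "0 < \<mu>" "0 < \<nu>" and Er_pos: "\<And>k \<omega>. \<omega> \<in> space P \<Longrightarrow> 0 \<le> Er k \<omega>"
    and Er0: "integrable P (Er 0)"
    and step: "\<And>k. AE \<omega> in P. nn_cond_exp P (Fl k) (\<lambda>\<omega>. ennreal (Er (Suc k) \<omega>)) \<omega> < \<infinity> \<and>
        real_cond_exp P (Fl k) (\<lambda>\<omega>. (norm (err k \<omega>))\<^sup>2) \<omega> + \<mu> * Er k \<omega>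
          \<le> c * (Er k \<omega> - real_cond_exp P (Fl k) (Er (Suc k)) \<omega>)
             + \<nu> * real_cond_exp P (Fl k) (\<lambda>\<omega>. (norm (\<eta> k \<omega>))\<^sup>2) \<omega>"
    using ed by (simp_all add: error_dissipation_def)
  have meas [measurable]: "Er k \<in> borel_measurable P" for k
    using ed measurable_from_subalg[OF sub] by (auto simp: error_dissipation_def)
  have fin: "sigma_finite_subalgebra P (Fl k)" for k
    by (intro finite_measure_subalgebra_is_sigma_finite finite_measure_subalgebra.intro
        finite_measure_subalgebra_axioms.intro sub) unfold_locales
  have int_Suc: "integrable P (Er (Suc k))" if k: "integrable P (Er k)" for k
  proof -
    interpret C: sigma_finite_subalgebra P "Fl k" by (rule fin)
    let ?e = "\<lambda>\<omega>. (norm (err k \<omega>))\<^sup>2" and ?n = "\<lambda>\<omega>. (norm (\<eta> k \<omega>))\<^sup>2"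
    let ?N = "nn_cond_exp P (Fl k) (\<lambda>\<omega>. ennreal (Er (Suc k) \<omega>))"
    \<comment> \<open>The dissipation inequality solved for the conditional expectation of
      \<open>Er (Suc k)\<close>, with the nonnegative left side bounded below by 0.\<close>
    define b where "b = (\<lambda>\<omega>. Er k \<omega> + \<nu> / c * real_cond_exp P (Fl k) ?n \<omega>)"
    have b: "integrable P b"
      unfolding b_def by (intro Bochner_Integration.integrable_add k integrable_mult_right C.real_cond_exp_int \<eta>)
    \<comment> \<open>\<open>real_cond_exp\<close> is a difference of two nonnegative conditional
      expectations; the one for the negative part vanishes here.\<close>
    have "AE \<omega> in P. nn_cond_exp P (Fl k) (\<lambda>\<omega>. ennreal (- Er (Suc k) \<omega>)) \<omega> = nn_cond_exp P (Fl k) (\<lambda>\<omega>. 0) \<omega>"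
      by (rule C.nn_cond_exp_cong) (auto simp: ennreal_neg Er_pos)
    moreover have "AE \<omega> in P. nn_cond_exp P (Fl k) (\<lambda>\<omega>. 0) \<omega> = 0"
      using C.nn_cond_exp_F_meas[of "\<lambda>\<omega>. 0"] by simp
    moreover have "AE \<omega> in P. real_cond_exp P (Fl k) ?e \<omega> \<ge> 0"
      by (rule C.real_cond_exp_pos) (use err in auto)
    ultimately have "AE \<omega> in P. ?N \<omega> \<le> ennreal (b \<omega>)"
      using step[of k] AE_space
    proof eventually_elim
      case (elim \<omega>)
      then have \<omega>: "\<omega> \<in> space P" by blast
      have "enn2real (?N \<omega>) = real_cond_exp P (Fl k) (Er (Suc k)) \<omega>"
        using elim by (simp add: real_cond_exp_def)
      moreover have "c * real_cond_exp P (Fl k) (Er (Suc k)) \<omega> \<le> c * Er k \<omega> + \<nu> * real_cond_exp P (Fl k) ?n \<omega>"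
        using elim pos mult_nonneg_nonneg[OF less_imp_le[OF pos(2)] Er_pos[OF \<omega>, of k]]
        by (simp only: right_diff_distrib) linarith
      ultimately have "enn2real (?N \<omega>) \<le> b \<omega>" using pos by (simp add: b_def field_simps)
      \<comment> \<open>Finiteness of the conditional expectation enters here, since
        \<open>enn2real\<close> sends infinity to 0.\<close>
      moreover have "?N \<omega> = ennreal (enn2real (?N \<omega>))" using elim by simp
      ultimately show ?case by (metis ennreal_leI)
    qed
    then have "(\<integral>\<^sup>+\<omega>. ?N \<omega> \<partial>P) \<le> (\<integral>\<^sup>+\<omega>. ennreal (b \<omega>) \<partial>P)" by (rule nn_integral_mono_AE)
    also have "\<dots> \<le> (\<integral>\<^sup>+\<omega>. ennreal (norm (b \<omega>)) \<partial>P)" by (intro nn_integral_mono ennreal_leI) simp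
    also have "\<dots> < \<infinity>" using b by (simp add: integrable_iff_bounded)
    also have "(\<integral>\<^sup>+\<omega>. ?N \<omega> \<partial>P) = (\<integral>\<^sup>+\<omega>. ennreal (Er (Suc k) \<omega>) \<partial>P)"
      using C.nn_cond_exp_intg[of "\<lambda>_. 1" "\<lambda>\<omega>. ennreal (Er (Suc k) \<omega>)"] by simp
    finally show ?thesis
      by (intro integrableI_nonneg) (auto simp: Er_pos)
  qed
  show int: "integrable P (Er k)" for k
    by (induction k) (simp_all add: Er0 int_Suc)
  show "(\<integral>\<omega>. (norm (err k \<omega>))\<^sup>2 \<partial>P)
      \<le> c * ((\<integral>\<omega>. Er k \<omega> \<partial>P) - (\<integral>\<omega>. Er (Suc k) \<omega> \<partial>P)) + \<nu> * (\<integral>\<omega>. (norm (\<eta> k \<omega>))\<^sup>2 \<partial>P)"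
  proof -
    interpret C: sigma_finite_subalgebra P "Fl k" by (rule fin)
    let ?e = "\<lambda>\<omega>. (norm (err k \<omega>))\<^sup>2" and ?n = "\<lambda>\<omega>. (norm (\<eta> k \<omega>))\<^sup>2"
    note ints = int C.real_cond_exp_int(1)[OF int] C.real_cond_exp_int(1)[OF err] C.real_cond_exp_int(1)[OF \<eta>]
    have "(\<integral>\<omega>. real_cond_exp P (Fl k) ?e \<omega> \<partial>P)
      \<le> (\<integral>\<omega>. c * (Er k \<omega> - real_cond_exp P (Fl k) (Er (Suc k)) \<omega>) + \<nu> * real_cond_exp P (Fl k) ?n \<omega> \<partial>P)"
    proof (rule integral_mono_AE)
      show "AE \<omega> in P. real_cond_exp P (Fl k) ?e \<omega>
          \<le> c * (Er k \<omega> - real_cond_exp P (Fl k) (Er (Suc k)) \<omega>) + \<nu> * real_cond_exp P (Fl k) ?n \<omega>"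
        using step[of k] AE_space
      proof eventually_elim
        case (elim \<omega>)
        then have \<omega>: "\<omega> \<in> space P" by blast
        from elim show ?case using mult_nonneg_nonneg[OF less_imp_le[OF pos(2)] Er_pos[OF \<omega>, of k]] by linarith
      qed
    qed (intro Bochner_Integration.integrable_add Bochner_Integration.integrable_diff integrable_mult_right ints int)+
    also have "\<dots> = c * ((\<integral>\<omega>. Er k \<omega> \<partial>P) - (\<integral>\<omega>. real_cond_exp P (Fl k) (Er (Suc k)) \<omega> \<partial>P))
        + \<nu> * (\<integral>\<omega>. real_cond_exp P (Fl k) ?n \<omega> \<partial>P)"
      using ints by simp
    finally show ?thesis by (simp add: C.real_cond_exp_int(2) int err \<eta>)
  qed
qed

text \<open>The tolerance of step \<open>k\<close> is charged to the previous step
  \<open>a (k - 1)\<close>, so after summation the coefficient of each \<open>a k\<close> loses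
  \<open>2 * L * \<kappa>\<close>; the error terms \<open>b k\<close> telescope through
  \<open>r\<close>.\<close>

lemma telescoped_descent:
  fixes a b d h r \<phi> \<sigma> :: "nat \<Rightarrow> real"
  assumes h: "\<And>k. h k \<le> \<phi> k - \<phi> (Suc k) - g * a k + 2 * L * d k + b k / (2 * \<tau>)"
    and d: "\<And>k. d k \<le> \<kappa> * (if k = 0 then 0 else a (k - 1)) + \<sigma> k"
    and b: "\<And>k. b k \<le> c * (r k - r (Suc k)) + \<nu> * a k"
    and nonneg: "0 \<le> L" "0 \<le> \<kappa>" "0 < \<tau>" "0 < c" "\<And>k. 0 \<le> a k" "\<And>k. 0 \<le> r k"
  shows "(\<Sum>k<K. h k) + (g - \<nu> / (2 * \<tau>) - 2 * L * \<kappa>) * (\<Sum>k<K. a k)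
      \<le> \<phi> 0 - \<phi> K + 2 * L * (\<Sum>k<K. \<sigma> k) + c / (2 * \<tau>) * r 0"
proof -
  define q where "q = (\<lambda>k. if k = 0 then 0 else a (k - 1))"
  \<comment> \<open>Strengthened for the induction: the surplus
    \<open>2 * L * \<kappa> * q K\<close> is set aside from the last step to pay for the tolerance
    \<open>d K\<close>, and \<open>r K\<close> is still to be telescoped.\<close>
  have "(\<Sum>k<K. h k) + (g - \<nu> / (2 * \<tau>) - 2 * L * \<kappa>) * (\<Sum>k<K. a k) + 2 * L * \<kappa> * q K + c / (2 * \<tau>) * r K
      \<le> \<phi> 0 - \<phi> K + 2 * L * (\<Sum>k<K. \<sigma> k) + c / (2 * \<tau>) * r 0"
  proof (induction K)
    case (Suc K)
    have "L * d K \<le> L * (\<kappa> * q K + \<sigma> K)" using d[of K] nonneg by (intro mult_left_mono) (auto simp: q_def)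
    moreover have "b K / (2 * \<tau>) \<le> (c * (r K - r (Suc K)) + \<nu> * a K) / (2 * \<tau>)"
      using b[of K] nonneg by (intro divide_right_mono) auto
    moreover have "\<dots> = c / (2 * \<tau>) * r K - c / (2 * \<tau>) * r (Suc K) + \<nu> / (2 * \<tau>) * a K"
      using nonneg by (simp add: field_simps)
    moreover have "q (Suc K) = a K" by (simp add: q_def)
    ultimately show ?case using Suc h[of K] by (simp add: algebra_simps add_divide_distrib diff_divide_distrib)
  qed (simp add: q_def)
  moreover have "0 \<le> 2 * L * \<kappa> * q K + c / (2 * \<tau>) * r K"
    using nonneg by (auto simp: q_def)
  ultimately show ?thesis by linarith
qed

text \<open>If all of the first \<open>N\<close> terms exceeded \<open>\<epsilon>\<^sup>2\<close>,
  their sum would exceed \<open>N * \<epsilon>\<^sup>2\<close>, which is at least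
  \<open>A\<close>.\<close>

lemma iteration_count:
  fixes E :: "nat \<Rightarrow> ennreal" and A Q c :: real
  assumes sum: "\<And>K. 1 \<le> K \<Longrightarrow> (\<Sum>k<K. E k) \<le> ennreal A"
    and A: "A \<le> c * Q" and c: "0 < c" and Q: "0 < Q"
  shows "\<exists>N :: real \<Rightarrow> nat.
         (\<lambda>\<epsilon>. real (N \<epsilon>)) \<in> O[at_right 0](\<lambda>\<epsilon>. Q / \<epsilon>\<^sup>2) \<and>
         (\<forall>\<epsilon>>0. 1 \<le> N \<epsilon> \<and> real (N \<epsilon>) \<le> c * Q / \<epsilon>\<^sup>2 + 1 \<and> (MIN k\<in>{..<N \<epsilon>}. E k) \<le> ennreal (\<epsilon>\<^sup>2))"
proof (intro exI conjI allI impI)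
  \<comment> \<open>The successor makes \<open>N\<close> at least the real quotient and also
    positive, so that the minimum ranges over a nonempty set.\<close>
  define N where "N = (\<lambda>\<epsilon>::real. Suc (nat \<lfloor>c * Q / \<epsilon>\<^sup>2\<rfloor>))"
  have nn: "0 \<le> c * Q / \<epsilon>\<^sup>2" for \<epsilon> using c Q by simp
  have le: "real (N \<epsilon>) \<le> c * Q / \<epsilon>\<^sup>2 + 1" and ge: "c * Q / \<epsilon>\<^sup>2 \<le> real (N \<epsilon>)" for \<epsilon>
    using nn[of \<epsilon>] unfolding N_def by linarith+
  show "(\<lambda>\<epsilon>. real (N \<epsilon>)) \<in> O[at_right 0](\<lambda>\<epsilon>. Q / \<epsilon>\<^sup>2)"
  \<comment> \<open>The part \<open>1 / Q\<close> absorbs the additive 1 from rounding, as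
    \<open>1 \<le> 1 / \<epsilon>\<^sup>2\<close> for small \<epsilon>.\<close>
  proof (rule bigoI[where c = "c + 1 / Q"])
    have "norm (real (N \<epsilon>)) \<le> (c + 1 / Q) * norm (Q / \<epsilon>\<^sup>2)" if e: "0 < \<epsilon>" "\<epsilon> < 1" for \<epsilon>
    proof -
      have "\<epsilon>\<^sup>2 \<le> 1" using e by (simp add: power_le_one)
      then have "1 \<le> 1 / \<epsilon>\<^sup>2" using e by simp
      moreover have "(c + 1 / Q) * norm (Q / \<epsilon>\<^sup>2) = c * Q / \<epsilon>\<^sup>2 + 1 / \<epsilon>\<^sup>2"
        using Q e by (simp add: field_simps)
      ultimately show ?thesis using le[of \<epsilon>] by simp
    qed
    then show "\<forall>\<^sub>F \<epsilon> in at_right 0. norm (real (N \<epsilon>)) \<le> (c + 1 / Q) * norm (Q / \<epsilon>\<^sup>2)"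
      by (auto simp: eventually_at_right_field intro!: exI[of _ 1])
  qed
  fix \<epsilon> :: real assume e: "0 < \<epsilon>"
  show N1: "1 \<le> N \<epsilon>" by (simp add: N_def)
  show "real (N \<epsilon>) \<le> c * Q / \<epsilon>\<^sup>2 + 1" by (rule le)
  show "(MIN k\<in>{..<N \<epsilon>}. E k) \<le> ennreal (\<epsilon>\<^sup>2)"
  proof (rule ccontr)
    define \<mu> where "\<mu> = (MIN k\<in>{..<N \<epsilon>}. E k)"
    assume "\<not> (MIN k\<in>{..<N \<epsilon>}. E k) \<le> ennreal (\<epsilon>\<^sup>2)"
    then have \<mu>: "ennreal (\<epsilon>\<^sup>2) < \<mu>" by (simp add: \<mu>_def)
    have "of_nat (N \<epsilon>) * \<mu> = (\<Sum>k<N \<epsilon>. \<mu>)" by simp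
    also have "\<dots> \<le> (\<Sum>k<N \<epsilon>. E k)" unfolding \<mu>_def by (intro sum_mono Min_le) auto
    also have "\<dots> \<le> ennreal A" by (rule sum[OF N1])
    also have "\<dots> \<le> ennreal (real (N \<epsilon>) * \<epsilon>\<^sup>2)"
      using ge[of \<epsilon>] A e by (intro ennreal_leI) (simp add: field_simps)
    also have "\<dots> = of_nat (N \<epsilon>) * ennreal (\<epsilon>\<^sup>2)"
      by (simp add: ennreal_mult ennreal_of_nat_eq_real_of_nat)
    also have "\<dots> < of_nat (N \<epsilon>) * \<mu>"
      using \<mu> N1 by (intro ennreal_mult_strict_left_mono) (auto simp: of_nat_less_top)
    finally show False by simp
  qed
qed

theorem theorem5p3:
  fixes M :: "(real^'d) set"
    and I :: "nat set" and V U :: "nat \<Rightarrow> (real^'d) set"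
    and \<psi> :: "nat \<Rightarrow> real^'d \<Rightarrow> real^'p"
    and sel :: "real^'d \<Rightarrow> nat" and B :: "real^'d \<Rightarrow> real^'d^'p"
    and Retr :: "real^'d \<Rightarrow> real^'d \<Rightarrow> real^'d"
    and n :: nat and f :: "nat \<Rightarrow> real^'d \<Rightarrow> real"
    and F R \<Phi> :: "real^'d \<Rightarrow> real"
    and Uf :: "(real^'d) set"
    and l\<^sub>f l\<^sub>R M\<^sub>f c\<^sub>f M\<^sub>u C\<^sub>0 \<delta> C\<^sub>R C\<^sub>Q L\<^sub>R L\<^sub>\<Phi> L\<^sub>F \<delta>\<^sub>T L\<^sub>T C\<^sub>\<alpha> :: real
    and \<alpha> \<alpha>bar \<gamma>0 \<Delta>bar chibar :: real
    and P :: "'w measure" and Fl :: "nat \<Rightarrow> 'w measure"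
    and MS :: "'s measure" and S :: "nat \<Rightarrow> 'w \<Rightarrow> 's"
    and batch :: "nat \<Rightarrow> 'w \<Rightarrow> nat multiset"
    and est :: "nat \<Rightarrow> real^'d \<Rightarrow> 's \<Rightarrow> nat multiset \<Rightarrow> real^'d"
    and x0 :: "real^'d"
    and x u uhat mbar m w \<eta> \<eta>hat err :: "nat \<Rightarrow> 'w \<Rightarrow> real^'d"
    and lam :: "nat \<Rightarrow> 'w \<Rightarrow> real^'p"
    and \<gamma> \<Delta> chi Er :: "nat \<Rightarrow> 'w \<Rightarrow> real"
    and c\<^sub>e \<mu> \<nu> \<kappa> :: real and \<sigma> :: "nat \<Rightarrow> real"
    and \<sigma>\<^sub>0 \<tau> a\<^sub>\<eta> a\<^sub>h C' C\<^sub>\<Theta> Cc :: real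
  \<comment> \<open>the manifold, its local defining functions, and the retraction\<close>
  assumes "compact M"
    and "defining_cover M I V U \<psi>"
    and "\<And>y. y \<in> M \<Longrightarrow> sel y \<in> I \<and> y \<in> V (sel y)"
    and "\<And>y. B y = jacobian (\<psi> (sel y)) (at y)"
    and "\<And>y. y \<in> M \<Longrightarrow> {v. B y *v v = 0} = tangent_space M y"
    and "0 < C\<^sub>0"
    and "\<And>y v. y \<in> M \<Longrightarrow> infdist v (tangent_space M y) \<le> C\<^sub>0 * norm (B y *v v)"
    and "manifold_retraction M Retr"
  \<comment> \<open>the objective\<close>
    and "1 \<le> n"
    and "\<And>j. j \<in> {1..n} \<Longrightarrow> C1_fun (f j)"
    and "open Uf" and "M \<subseteq> Uf"
    and "\<And>j. j \<in> {1..n} \<Longrightarrow> l\<^sub>f-lipschitz_on Uf (nabla (f j))"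
    and "0 < M\<^sub>f"
    and "\<And>j y. j \<in> {1..n} \<Longrightarrow> y \<in> M \<Longrightarrow> norm (nabla (f j) y) \<le> M\<^sub>f"
    and "convex_on UNIV R" and "l\<^sub>R-lipschitz_on UNIV R"
    and "F = (\<lambda>y. (\<Sum>j=1..n. f j y) / real n)"
    and "\<Phi> = (\<lambda>y. F y + R y)"
  \<comment> \<open>the fixed constants\<close>
    and "0 < \<delta>" "0 < C\<^sub>R" "0 < C\<^sub>Q" "0 < L\<^sub>R" "0 < L\<^sub>\<Phi>" "0 < L\<^sub>F"
    and "\<And>y v. y \<in> M \<Longrightarrow> v \<in> tangent_space M y \<Longrightarrow> norm v \<le> \<delta> \<Longrightarrow>
           y + v \<in> Uf \<and>
           norm (Retr y v - y) \<le> C\<^sub>R * norm v \<and>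
           norm (Retr y v - y - v) \<le> C\<^sub>Q * (norm v)\<^sup>2 \<and>
           \<bar>R (Retr y v) - R (y + v)\<bar> \<le> L\<^sub>R * (norm v)\<^sup>2 \<and>
           \<bar>\<Phi> (Retr y v) - \<Phi> (y + v)\<bar> \<le> L\<^sub>\<Phi> * (norm v)\<^sup>2 \<and>
           F (Retr y v) - F y - riem_grad M F y \<bullet> v \<le> L\<^sub>F / 2 * (norm v)\<^sup>2"
    and "0 < \<delta>\<^sub>T" "0 < L\<^sub>T"
    and "\<And>h. h \<in> insert F (f ` {1..n}) \<Longrightarrow> grad_transport_lipschitz M Retr \<delta>\<^sub>T L\<^sub>T h"
    and "1 \<le> c\<^sub>f" and "M\<^sub>u = c\<^sub>f * M\<^sub>f"
    and "C\<^sub>\<alpha> = ((sqrt (l\<^sub>R * C\<^sub>0 * \<Delta>bar + (M\<^sub>u + l\<^sub>R) * min \<delta> \<delta>\<^sub>T) - sqrt (l\<^sub>R * C\<^sub>0 * \<Delta>bar))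
                / (M\<^sub>u + l\<^sub>R))\<^sup>2"
  \<comment> \<open>algorithm parameters\<close>
    and "0 < \<alpha>" and "\<alpha> \<le> \<alpha>bar"
    and "0 < \<gamma>0" and "\<gamma>0 \<le> 1" and "0 \<le> \<Delta>bar" and "0 \<le> chibar" and "chibar < 1"
  \<comment> \<open>randomness: \<open>Fl k\<close> is the history before the \<open>k\<close>-th batch is sampled\<close>
    and "prob_space P"
    and "filtration (space P) Fl" and "\<And>k. subalgebra P (Fl k)"
    and "\<And>k. x k \<in> borel_measurable (Fl k)"
    and "\<And>k. mbar k \<in> borel_measurable (Fl k)"
    and "\<And>k. \<gamma> k \<in> borel_measurable (Fl k)"
    and "\<And>k. \<Delta> k \<in> borel_measurable (Fl k)"
    and "\<And>k. chi k \<in> borel_measurable (Fl k)"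
    and "\<And>k. S k \<in> measurable (Fl k) MS"
    and "\<And>k. 1 \<le> k \<Longrightarrow> batch k \<in> measurable (Fl (Suc k)) (count_space UNIV)"
    and "\<And>k. u k \<in> borel_measurable (Fl (Suc k))"
    and "\<And>k. lam k \<in> borel_measurable (Fl (Suc k))"
    and "\<And>k. w k \<in> borel_measurable (Fl (Suc k))"
    and "\<And>k. \<eta> k \<in> borel_measurable (Fl (Suc k))"
    and "\<And>k \<omega>. \<omega> \<in> space P \<Longrightarrow> \<gamma> k \<omega> \<in> {\<gamma>0..1} \<and> \<Delta> k \<omega> \<in> {0..\<Delta>bar} \<and> chi k \<omega> \<in> {0..chibar}"
  \<comment> \<open>the iteration\<close>
    and "x0 \<in> M"
    and "\<And>\<omega>. \<omega> \<in> space P \<Longrightarrow> x 0 \<omega> = x0 \<and> u 0 \<omega> = riem_grad M F x0 \<and>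
           uhat 0 \<omega> = riem_grad M F x0 \<and> mbar 0 \<omega> = riem_grad M F x0"
    and "\<And>k \<omega>. 1 \<le> k \<Longrightarrow> \<omega> \<in> space P \<Longrightarrow>
           set_mset (batch k \<omega>) \<subseteq> {1..n} \<and>
           u k \<omega> = est k (x k \<omega>) (S k \<omega>) (batch k \<omega>) \<and>
           u k \<omega> \<in> tangent_space M (x k \<omega>) \<and>
           uhat k \<omega> = closest_point (cball 0 M\<^sub>u) (u k \<omega>)"
    and "\<And>k \<omega>. \<omega> \<in> space P \<Longrightarrow> m k \<omega> = chi k \<omega> *\<^sub>R mbar k \<omega> + (1 - chi k \<omega>) *\<^sub>R uhat k \<omega>"
    and "\<And>k \<omega>. \<omega> \<in> space P \<Longrightarrow>
           norm (nabla (dual_fun \<alpha> R (B (x k \<omega>)) (m k \<omega>) (x k \<omega>)) (lam k \<omega>)) \<le> \<Delta> k \<omega>"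
    and "\<And>k \<omega>. \<omega> \<in> space P \<Longrightarrow>
           w k \<omega> = prox \<alpha> R (x k \<omega> - \<alpha> *\<^sub>R (m k \<omega> + transpose (B (x k \<omega>)) *v lam k \<omega>)) - x k \<omega>"
    and "\<And>k \<omega>. \<omega> \<in> space P \<Longrightarrow> \<eta> k \<omega> = proj_tangent M (x k \<omega>) (w k \<omega>)"
    and "\<And>k \<omega>. \<omega> \<in> space P \<Longrightarrow> x (Suc k) \<omega> = Retr (x k \<omega>) (\<gamma> k \<omega> *\<^sub>R \<eta> k \<omega>)"
    and "\<And>k \<omega>. \<omega> \<in> space P \<Longrightarrow> mbar (Suc k) \<omega> = proj_tangent M (x (Suc k) \<omega>) (m k \<omega>)"
    and "\<And>k \<omega>. \<omega> \<in> space P \<Longrightarrow> \<eta>hat k \<omega> = exact_step M \<alpha> R (m k \<omega>) (x k \<omega>)"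
    and "\<And>k \<omega>. \<omega> \<in> space P \<Longrightarrow> err k \<omega> = m k \<omega> - riem_grad M F (x k \<omega>)"
  \<comment> \<open>error dissipation, inner tolerances, stepsize bound\<close>
    and "error_dissipation P Fl c\<^sub>e \<mu> \<nu> Er err \<eta>"
    and "0 \<le> \<kappa>" and "\<And>k. \<sigma> k \<in> {0..\<Delta>bar}"
    and "\<And>k \<omega>. \<omega> \<in> space P \<Longrightarrow>
           \<Delta> k \<omega> = min \<Delta>bar (max (\<kappa> * (norm (if k = 0 then 0 else \<eta> (k - 1) \<omega>))\<^sup>2) (\<sigma> k))"
    and "0 < \<alpha>bar"
    and "\<alpha>bar < min C\<^sub>\<alpha>
           (1 / (L\<^sub>F + 2 * L\<^sub>R + 2 * sqrt (\<nu> / \<gamma>0) + 4 * l\<^sub>R * C\<^sub>0 * \<kappa> / \<gamma>0))"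
  \<comment> \<open>derived constants\<close>
    and "\<sigma>\<^sub>0 = 1 / (2 * \<alpha>) - L\<^sub>F / 2 - L\<^sub>R"
    and "\<tau> = sqrt (\<nu> / \<gamma>0)"
    and "a\<^sub>\<eta> = \<gamma>0 * (\<sigma>\<^sub>0 - \<tau> / 2) - \<nu> / (2 * \<tau>) - 2 * l\<^sub>R * C\<^sub>0 * \<kappa>"
    and "a\<^sub>h = \<gamma>0 / (2 * \<alpha>)"
    and "C' = \<Phi> x0 - (INF y\<in>M. \<Phi> y) + 2 * l\<^sub>R * C\<^sub>0 * (\<Sum>k. \<sigma> k)"
    and "C\<^sub>\<Theta> = 1 + 2 * (l\<^sub>f + 1 / \<alpha>)\<^sup>2"
    and "Cc = max (C\<^sub>\<Theta> / a\<^sub>h) (2 * \<nu> / a\<^sub>\<eta>)"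
  shows "0 < a\<^sub>\<eta> \<and>
    (summable \<sigma> \<longrightarrow>
      (\<forall>K\<ge>1. (\<Sum>k<K. \<integral>\<^sup>+\<omega>. ennreal ((Theta F R M (x k \<omega>) (\<eta>hat k \<omega>))\<^sup>2) \<partial>P)
          \<le> ennreal (Cc * C' + c\<^sub>e * (2 + Cc / (2 * \<tau>)) * (\<integral>\<omega>. Er 0 \<omega> \<partial>P)))
      \<and>
      (\<exists>N :: real \<Rightarrow> nat.
         (\<lambda>\<epsilon>. real (N \<epsilon>)) \<in>
            O[at_right 0](\<lambda>\<epsilon>. (Cc + c\<^sub>e * (1 + Cc / \<tau>) * (\<integral>\<omega>. Er 0 \<omega> \<partial>P)) / \<epsilon>\<^sup>2) \<and>
         (\<forall>\<epsilon>>0. 1 \<le> N \<epsilon> \<and>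
            real (N \<epsilon>) \<le> max 2 C' * (Cc + c\<^sub>e * (1 + Cc / \<tau>) * (\<integral>\<omega>. Er 0 \<omega> \<partial>P)) / \<epsilon>\<^sup>2 + 1 \<and>
            (MIN k\<in>{..<N \<epsilon>}. \<integral>\<^sup>+\<omega>. ennreal ((Theta F R M (x k \<omega>) (\<eta>hat k \<omega>))\<^sup>2) \<partial>P)
              \<le> ennreal (\<epsilon>\<^sup>2))))"
proof -
  note ker = assms(5) and C0 = assms(6,7) and R = assms(16) and L = assms(17)
    and F = assms(18) and Phi = assms(19) and const = assms(26) and sub = assms(42)
    and range = assms(54) and init = assms(56) and batch_step = assms(57) and m_eq = assms(58)
    and err_eq = assms(65) and ed = assms(66)
  note pos = assms(20-25) assms(27) assms(33) assms(35)
  note average = assms(9,10) and compact_M = assms(1) and cover = assms(2) and sel = assms(3) and B_eq = assms(4) and retraction = assms(8) and M_subset = assms(12) and lipschitz_f = assms(13)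
    and M\<^sub>f_pos = assms(14) and norm_f = assms(15) and c\<^sub>f_ge = assms(30) and M\<^sub>u_eq = assms(31) and C\<^sub>\<alpha>_eq = assms(32) and \<alpha>_le = assms(34)
    and chibar_less = assms(39) and x_adapted = assms(43) and mbar_adapted = assms(44) and \<Delta>_adapted = assms(46) and chi_adapted = assms(47) and u_adapted = assms(50)
    and \<eta>_adapted = assms(53) and x0_in = assms(55) and dual_tolerance = assms(59) and w_eq = assms(60) and \<eta>_eq = assms(61) and x_Suc = assms(62) and mbar_Suc = assms(63)
    and \<eta>hat_eq = assms(64) and \<kappa>_nonneg = assms(67) and \<sigma>_range = assms(68) and \<Delta>_eq = assms(69) and \<alpha>bar_less = assms(71) and \<sigma>\<^sub>0_eq = assms(72)
    and \<tau>_eq = assms(73) and a\<^sub>\<eta>_eq = assms(74) and a\<^sub>h_eq = assms(75) and C'_eq = assms(76) and C\<^sub>\<Theta>_eq = assms(77) and Cc_eq = assms(78)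

  \<comment> \<open>Constants and the two stepsize bounds\<close>
  define d where "d = min \<delta> \<delta>\<^sub>T"
  have d: "0 < d" "d \<le> \<delta>" using pos by (simp_all add: d_def)
  have l: "0 \<le> l\<^sub>R" using L by (rule lipschitz_on_nonneg)
  have lf: "0 \<le> l\<^sub>f" using average(1) lipschitz_on_nonneg[OF lipschitz_f[of 1]] by simp
  have Mu: "0 < M\<^sub>u" "M\<^sub>f \<le> M\<^sub>u"
    using M\<^sub>f_pos c\<^sub>f_ge M\<^sub>u_eq mult_right_mono[of 1 c\<^sub>f M\<^sub>f] by auto
  have c: "0 < c\<^sub>e" "0 < \<mu>" "0 < \<nu>" and Er_nonneg: "\<And>k \<omega>. \<omega> \<in> space P \<Longrightarrow> 0 \<le> Er k \<omega>"
    using ed by (simp_all add: error_dissipation_def)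
  have \<tau>: "0 < \<tau>" "\<nu> = \<gamma>0 * \<tau>\<^sup>2" using c pos by (simp_all add: \<tau>_eq)
  define LC where "LC = l\<^sub>R * C\<^sub>0"
  have LC: "0 \<le> LC" using l C0 by (simp add: LC_def)
  have LCk: "0 \<le> 4 * LC * \<kappa> / \<gamma>0" using LC \<kappa>_nonneg pos by simp
  have \<sigma>0: "\<sigma>\<^sub>0 > \<tau> + 2 * LC * \<kappa> / \<gamma>0"
  proof -
    define D where "D = L\<^sub>F + 2 * L\<^sub>R + 2 * \<tau> + 4 * LC * \<kappa> / \<gamma>0"
    have D: "0 < D" using pos \<tau> LCk unfolding D_def by linarith
    have "D = L\<^sub>F + 2 * L\<^sub>R + 2 * sqrt (\<nu> / \<gamma>0) + 4 * l\<^sub>R * C\<^sub>0 * \<kappa> / \<gamma>0"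
      by (simp add: D_def LC_def \<tau>_eq)
    then have "\<alpha> < 1 / D" using \<alpha>_le \<alpha>bar_less by simp
    then have "D < 1 / \<alpha>" using D pos by (simp add: pos_less_divide_eq mult.commute)
    then have "D / 2 < 1 / (2 * \<alpha>)" by simp
    then show ?thesis unfolding \<sigma>\<^sub>0_eq D_def by (simp add: add_divide_distrib)
  qed
  have a\<eta>: "0 < a\<^sub>\<eta>"
  proof -
    have "\<nu> / (2 * \<tau>) = \<gamma>0 * (\<tau> / 2)" using \<tau> by (simp add: power2_eq_square)
    then have "a\<^sub>\<eta> = \<gamma>0 * (\<sigma>\<^sub>0 - (\<tau> + 2 * LC * \<kappa> / \<gamma>0))"
      using pos by (simp add: a\<^sub>\<eta>_eq LC_def field_simps)
    then show ?thesis using \<sigma>0 pos by simp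
  qed
  have ah: "0 < a\<^sub>h" using pos by (simp add: a\<^sub>h_eq)
  have \<alpha>: "\<alpha> < ((sqrt (l\<^sub>R * C\<^sub>0 * \<Delta>bar + (M\<^sub>u + l\<^sub>R) * d) - sqrt (l\<^sub>R * C\<^sub>0 * \<Delta>bar)) / (M\<^sub>u + l\<^sub>R))\<^sup>2"
    using C\<^sub>\<alpha>_eq \<alpha>_le \<alpha>bar_less by (simp add: d_def)

  \<comment> \<open>The objective and its gradient on the manifold\<close>
  have T: "subspace (tangent_space M y)" if "y \<in> M" for y
    unfolding ker[OF that, symmetric] by (rule linear_subspace_kernel) simp
  have nF: "norm (nabla F y) \<le> M\<^sub>f" if "y \<in> M" for y
    unfolding F by (rule norm_nabla_average_le[OF average]) (simp_all add: norm_f that)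
  have lipF: "norm (nabla F y - nabla F z) \<le> l\<^sub>f * norm (y - z)" if "y \<in> Uf" "z \<in> Uf" for y z
    unfolding F by (rule lipschitz_nabla_average[OF average lipschitz_f that])
  have contF: "continuous_on S F" for S
    unfolding F by (rule continuous_on_average[OF average])
  have cont\<Phi>: "continuous_on S \<Phi>" for S
    unfolding Phi using lipschitz_on_continuous_on[OF L]
    by (intro continuous_on_add contF) (auto intro: continuous_on_subset)
  have grad_T: "riem_grad M F y \<in> tangent_space M y" and grad_norm: "norm (riem_grad M F y) \<le> M\<^sub>f" if "y \<in> M" for y
    using closest_point_subspace_in[OF T[OF that]] norm_closest_point_subspace_le[OF T[OF that], of "nabla F y"] nF[OF that]
    by (auto simp: riem_grad_def)
  have cont_grad: "continuous_on M (riem_grad M F)"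
  proof (rule continuous_on_riem_grad[OF cover sel])
    show "{v. jacobian (\<psi> (sel y)) (at y) *v v = 0} = tangent_space M y" if "y \<in> M" for y
      using ker[OF that] by (simp add: B_eq)
    show "continuous_on M (nabla F)" unfolding F by (rule continuous_on_nabla_average[OF average])
  qed

  \<comment> \<open>Feasibility of the iterates and size of the steps\<close>
  have inv_step: "m k \<omega> \<in> tangent_space M (x k \<omega>) \<and> norm (m k \<omega>) \<le> M\<^sub>u"
    if \<omega>: "\<omega> \<in> space P" and x: "x k \<omega> \<in> M"
      and mb: "mbar k \<omega> \<in> tangent_space M (x k \<omega>)" "norm (mbar k \<omega>) \<le> M\<^sub>u" for k \<omega>
  proof -
    have u: "uhat k \<omega> \<in> tangent_space M (x k \<omega>)" "norm (uhat k \<omega>) \<le> M\<^sub>u"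
    proof (atomize (full), cases "k = 0")
      \<comment> \<open>The initial estimator is not clipped; its bound comes from
        \<open>M\<^sub>f \<le> M\<^sub>u\<close>.\<close>
      case True
      then show "uhat k \<omega> \<in> tangent_space M (x k \<omega>) \<and> norm (uhat k \<omega>) \<le> M\<^sub>u"
        using init[OF \<omega>] grad_T[OF x0_in] grad_norm[OF x0_in] Mu by auto
    next
      case False
      then show "uhat k \<omega> \<in> tangent_space M (x k \<omega>) \<and> norm (uhat k \<omega>) \<le> M\<^sub>u"
        using batch_step[OF _ \<omega>, of k] closest_point_cball_subspace[OF T[OF x], of "u k \<omega>" M\<^sub>u] Mu by auto
    qed
    have chi: "0 \<le> chi k \<omega>" "chi k \<omega> \<le> 1" using range[OF \<omega>, of k] chibar_less by auto
    have "norm (m k \<omega>) \<le> chi k \<omega> * norm (mbar k \<omega>) + (1 - chi k \<omega>) * norm (uhat k \<omega>)"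
      using norm_triangle_ineq[of "chi k \<omega> *\<^sub>R mbar k \<omega>" "(1 - chi k \<omega>) *\<^sub>R uhat k \<omega>"] chi
      by (simp add: m_eq[OF \<omega>])
    also have "\<dots> \<le> M\<^sub>u" using chi mb(2) u(2) by (intro convex_bound_le) auto
    finally show ?thesis
      using mb u by (auto simp: m_eq[OF \<omega>] intro!: subspace_add subspace_scale T x)
  qed
  have step: "\<eta> k \<omega> \<in> tangent_space M (x k \<omega>)" "norm (\<eta> k \<omega>) \<le> d"
      "is_arg_min (tangent_model \<alpha> R (m k \<omega>) (x k \<omega>)) (\<lambda>v. v \<in> tangent_space M (x k \<omega>)) (\<eta>hat k \<omega>)"
      "norm (\<eta>hat k \<omega>) \<le> d"
      "tangent_model \<alpha> R (m k \<omega>) (x k \<omega>) (\<eta> k \<omega>)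
        \<le> R (x k \<omega>) - (norm (\<eta>hat k \<omega>))\<^sup>2 / (2 * \<alpha>) + 2 * (l\<^sub>R * C\<^sub>0) * \<Delta> k \<omega>"
    if \<omega>: "\<omega> \<in> space P" and x: "x k \<omega> \<in> M"
      and m: "m k \<omega> \<in> tangent_space M (x k \<omega>)" "norm (m k \<omega>) \<le> M\<^sub>u" for k \<omega>
  proof -
    have \<Delta>: "0 \<le> \<Delta> k \<omega>" "\<Delta> k \<omega> \<le> \<Delta>bar" using range[OF \<omega>, of k] by auto
    note it = iteration_step[OF ker[OF x] C0(1) C0(2)[OF x] R L pos(8) d(1) Mu(1) \<alpha> \<Delta> m dual_tolerance[OF \<omega>] w_eq[OF \<omega>]]
    from it show "\<eta> k \<omega> \<in> tangent_space M (x k \<omega>)" "norm (\<eta> k \<omega>) \<le> d"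
      "is_arg_min (tangent_model \<alpha> R (m k \<omega>) (x k \<omega>)) (\<lambda>v. v \<in> tangent_space M (x k \<omega>)) (\<eta>hat k \<omega>)"
      "norm (\<eta>hat k \<omega>) \<le> d"
      "tangent_model \<alpha> R (m k \<omega>) (x k \<omega>) (\<eta> k \<omega>)
        \<le> R (x k \<omega>) - (norm (\<eta>hat k \<omega>))\<^sup>2 / (2 * \<alpha>) + 2 * (l\<^sub>R * C\<^sub>0) * \<Delta> k \<omega>"
      unfolding \<eta>_eq[OF \<omega>] \<eta>hat_eq[OF \<omega>] by blast+
  qed
  \<comment> \<open>The facts \<open>inv_step\<close> and \<open>step\<close> are conditional on the
    state at one index, so that they can be applied inside this induction.\<close>
  have inv: "x k \<omega> \<in> M \<and> mbar k \<omega> \<in> tangent_space M (x k \<omega>) \<and> norm (mbar k \<omega>) \<le> M\<^sub>u"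
    if \<omega>: "\<omega> \<in> space P" for k \<omega>
  proof (induction k)
    case 0
    show ?case using init[OF \<omega>] x0_in grad_T[OF x0_in] grad_norm[OF x0_in] Mu by auto
  next
    case (Suc k)
    then have x: "x k \<omega> \<in> M" by blast
    have m: "m k \<omega> \<in> tangent_space M (x k \<omega>)" "norm (m k \<omega>) \<le> M\<^sub>u" using inv_step[OF \<omega>] Suc by auto
    have "(x k \<omega>, \<gamma> k \<omega> *\<^sub>R \<eta> k \<omega>) \<in> tangent_bundle M"
      using x subspace_scale[OF T[OF x] step(1)[OF \<omega> x m]] by (simp add: tangent_bundle_def)
    then have x': "x (Suc k) \<omega> \<in> M"
      using retraction by (auto simp: manifold_retraction_def x_Suc[OF \<omega>])
    then show ?case
      using closest_point_subspace_in[OF T[OF x']] norm_closest_point_subspace_le[OF T[OF x'], of "m k \<omega>"] m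
      by (auto simp: mbar_Suc[OF \<omega>])
  qed
  have xM: "x k \<omega> \<in> M" and m: "m k \<omega> \<in> tangent_space M (x k \<omega>)" "norm (m k \<omega>) \<le> M\<^sub>u"
    if "\<omega> \<in> space P" for k \<omega>
    using inv[OF that, of k] inv_step[OF that, of k] by auto
  \<comment> \<open>The discharged premises each bring back \<open>\<omega> \<in> space P\<close>,
    hence the repeated instantiations below.\<close>
  note step = step[OF _ xM m]

  \<comment> \<open>Pathwise descent and the criticality bound\<close>
  define h where "h = (\<lambda>k \<omega>. \<Phi> (x k \<omega>) - \<Phi> (x (Suc k) \<omega>) - \<gamma>0 * (\<sigma>\<^sub>0 - \<tau> / 2) * (norm (\<eta> k \<omega>))\<^sup>2
      + 2 * LC * \<Delta> k \<omega> + (norm (err k \<omega>))\<^sup>2 / (2 * \<tau>))"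
  \<comment> \<open>No \<open>\<eta>hat\<close> occurs in \<open>h\<close>, which makes it the
    measurable substitute. The factor \<open>\<gamma> k\<close> is lowered to
    \<open>\<gamma>0\<close> in both squared terms, whose coefficients are nonnegative.\<close>
  have hat_le: "a\<^sub>h * (norm (\<eta>hat k \<omega>))\<^sup>2 \<le> h k \<omega>" if \<omega>: "\<omega> \<in> space P" for k \<omega>
  proof -
    let ?t = "\<gamma> k \<omega>"
    have t: "0 \<le> ?t" "?t \<le> 1" "\<gamma>0 \<le> ?t" using range[OF \<omega>, of k] pos by auto
    have "norm (?t *\<^sub>R \<eta> k \<omega>) \<le> norm (\<eta> k \<omega>)" using t by (simp add: mult_left_le_one_le)
    then have "norm (?t *\<^sub>R \<eta> k \<omega>) \<le> \<delta>" using step(2)[OF \<omega> \<omega> \<omega> \<omega>, of k] d by linarith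
    note bounds = const[OF xM[OF \<omega>] subspace_scale[OF T[OF xM[OF \<omega>]] step(1)[OF \<omega> \<omega> \<omega> \<omega>]] this]
    have "F (x (Suc k) \<omega>) + R (x (Suc k) \<omega>) \<le> F (x k \<omega>) + R (x k \<omega>)
        - ?t * (1 / (2 * \<alpha>) - L\<^sub>F / 2 - L\<^sub>R - \<tau> / 2) * (norm (\<eta> k \<omega>))\<^sup>2
        - ?t / (2 * \<alpha>) * (norm (\<eta>hat k \<omega>))\<^sup>2 + 2 * LC * \<Delta> k \<omega> + (norm (m k \<omega> - riem_grad M F (x k \<omega>)))\<^sup>2 / (2 * \<tau>)"
    proof (rule retraction_step_descent[OF R t(1,2) \<tau>(1)])
      show "0 \<le> L\<^sub>F" "0 \<le> L\<^sub>R" using pos by auto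
      show "0 \<le> 2 * LC * \<Delta> k \<omega>" using LC range[OF \<omega>, of k] by simp
      show "F (x (Suc k) \<omega>) - F (x k \<omega>) - riem_grad M F (x k \<omega>) \<bullet> (?t *\<^sub>R \<eta> k \<omega>) \<le> L\<^sub>F / 2 * (norm (?t *\<^sub>R \<eta> k \<omega>))\<^sup>2"
        using bounds unfolding x_Suc[OF \<omega>] by blast
      show "R (x (Suc k) \<omega>) - R (x k \<omega> + ?t *\<^sub>R \<eta> k \<omega>) \<le> L\<^sub>R * (norm (?t *\<^sub>R \<eta> k \<omega>))\<^sup>2"
        using bounds unfolding x_Suc[OF \<omega>] by linarith
      show "tangent_model \<alpha> R (m k \<omega>) (x k \<omega>) (\<eta> k \<omega>)
        \<le> R (x k \<omega>) - (norm (\<eta>hat k \<omega>))\<^sup>2 / (2 * \<alpha>) + 2 * LC * \<Delta> k \<omega>"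
        using step(5)[OF \<omega> \<omega> \<omega> \<omega>] by (simp add: LC_def)
    qed
    moreover have "\<gamma>0 * (\<sigma>\<^sub>0 - \<tau> / 2) * (norm (\<eta> k \<omega>))\<^sup>2 \<le> ?t * (\<sigma>\<^sub>0 - \<tau> / 2) * (norm (\<eta> k \<omega>))\<^sup>2"
      using t \<sigma>0 \<tau> LCk by (intro mult_right_mono) auto
    moreover have "a\<^sub>h * (norm (\<eta>hat k \<omega>))\<^sup>2 \<le> ?t / (2 * \<alpha>) * (norm (\<eta>hat k \<omega>))\<^sup>2"
      unfolding a\<^sub>h_eq using t pos by (intro mult_right_mono divide_right_mono) auto
    ultimately show ?thesis
      unfolding h_def Phi err_eq[OF \<omega>] \<sigma>\<^sub>0_eq by linarith
  qed
  have h_nonneg: "0 \<le> h k \<omega>" if "\<omega> \<in> space P" for k \<omega>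
    using order_trans[OF _ hat_le[OF that, of k]] ah by simp
  have C\<Theta>: "0 \<le> C\<^sub>\<Theta>" by (simp add: C\<^sub>\<Theta>_eq)
  have Theta_le: "(Theta F R M (x k \<omega>) (\<eta>hat k \<omega>))\<^sup>2 \<le> C\<^sub>\<Theta> / a\<^sub>h * h k \<omega> + 2 * (norm (err k \<omega>))\<^sup>2"
    if \<omega>: "\<omega> \<in> space P" for k \<omega>
  proof -
    note v = step(3,4)[OF \<omega> \<omega> \<omega> \<omega>, of k]
    have "\<eta>hat k \<omega> \<in> tangent_space M (x k \<omega>)" using v(1) by (simp add: is_arg_min_def)
    then have "x k \<omega> + \<eta>hat k \<omega> \<in> Uf" using const[OF xM[OF \<omega>]] v(2) d by force
    then have "norm (nabla F (x k \<omega> + \<eta>hat k \<omega>) - nabla F (x k \<omega>)) \<le> l\<^sub>f * norm (\<eta>hat k \<omega>)"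
      using lipF[of "x k \<omega> + \<eta>hat k \<omega>" "x k \<omega>"] M_subset xM[OF \<omega>] by auto
    from Theta_square_le[OF T[OF xM[OF \<omega>]] pos(8) R v(1) lf this]
    have "(Theta F R M (x k \<omega>) (\<eta>hat k \<omega>))\<^sup>2 \<le> C\<^sub>\<Theta> * (norm (\<eta>hat k \<omega>))\<^sup>2 + 2 * (norm (err k \<omega>))\<^sup>2"
      by (simp add: C\<^sub>\<Theta>_eq err_eq[OF \<omega>])
    moreover have "C\<^sub>\<Theta> * (norm (\<eta>hat k \<omega>))\<^sup>2 \<le> C\<^sub>\<Theta> * (h k \<omega> / a\<^sub>h)"
      using hat_le[OF \<omega>, of k] ah C\<Theta> by (intro mult_left_mono) (simp_all add: field_simps)
    ultimately show ?thesis by simp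
  qed

  \<comment> \<open>Measurability and integrability\<close>
  interpret prob_space P by fact
  have from_sub: "g \<in> borel_measurable P" if "g \<in> borel_measurable (Fl k)" for g :: "'w \<Rightarrow> 'b::topological_space" and k
    by (rule measurable_from_subalg[OF sub that])
  have x_meas [measurable]: "x k \<in> borel_measurable P" for k by (rule from_sub[OF x_adapted])
  have \<eta>_meas [measurable]: "\<eta> k \<in> borel_measurable P" for k by (rule from_sub[OF \<eta>_adapted])
  have \<Delta>_meas [measurable]: "\<Delta> k \<in> borel_measurable P" for k by (rule from_sub[OF \<Delta>_adapted])
  have uhat_meas [measurable]: "uhat k \<in> borel_measurable P" for k
  proof (cases "k = 0")
    case True
    have "(\<lambda>_. riem_grad M F x0) \<in> borel_measurable P" by simp
    then show ?thesis using init True by (simp cong: measurable_cong)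
  next
    case False
    have "continuous_on UNIV (closest_point (cball 0 M\<^sub>u :: (real^'d) set))"
      using Mu by (intro continuous_on_closest_point) auto
    then have "(\<lambda>\<omega>. closest_point (cball 0 M\<^sub>u) (u k \<omega>)) \<in> borel_measurable P"
      using measurable_compose[OF from_sub[OF u_adapted] borel_measurable_continuous_onI] by blast
    then show ?thesis using batch_step False by (simp cong: measurable_cong)
  qed
  have m_meas [measurable]: "m k \<in> borel_measurable P" for k
  proof -
    have [measurable]: "chi k \<in> borel_measurable P" "mbar k \<in> borel_measurable P"
      by (rule from_sub[OF chi_adapted], rule from_sub[OF mbar_adapted])
    have "(\<lambda>\<omega>. chi k \<omega> *\<^sub>R mbar k \<omega> + (1 - chi k \<omega>) *\<^sub>R uhat k \<omega>) \<in> borel_measurable P" by measurable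
    then show ?thesis using m_eq by (simp cong: measurable_cong)
  qed
  \<comment> \<open>The iterates take values in \<open>M\<close>, so continuity of the gradient on
    \<open>M\<close> suffices.\<close>
  have grad_meas [measurable]: "(\<lambda>\<omega>. riem_grad M F (x k \<omega>)) \<in> borel_measurable P" for k
  proof -
    have "x k \<in> measurable P (restrict_space borel M)"
      by (intro measurable_restrict_space2 x_meas) (auto simp: xM)
    moreover have "riem_grad M F \<in> borel_measurable (restrict_space borel M)"
      by (rule borel_measurable_continuous_on_restrict[OF cont_grad])
    ultimately show ?thesis by (rule measurable_compose)
  qed
  have err_meas [measurable]: "err k \<in> borel_measurable P" for k
  proof -
    have "(\<lambda>\<omega>. m k \<omega> - riem_grad M F (x k \<omega>)) \<in> borel_measurable P" by measurable
    then show ?thesis using err_eq by (simp cong: measurable_cong)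
  qed
  have \<Phi>_meas [measurable]: "(\<lambda>\<omega>. \<Phi> (x k \<omega>)) \<in> borel_measurable P" for k
    by (rule measurable_compose[OF x_meas borel_measurable_continuous_onI[OF cont\<Phi>]])
  \<comment> \<open>Compactness of \<open>M\<close> and the bounds on steps, errors and tolerances
    make all terms of \<open>h\<close> bounded, hence integrable.\<close>
  have "bounded (\<Phi> ` M)" by (rule compact_imp_bounded[OF compact_continuous_image[OF cont\<Phi> compact_M]])
  then obtain Q where Q: "\<And>y. y \<in> M \<Longrightarrow> \<bar>\<Phi> y\<bar> \<le> Q" by (auto simp: bounded_iff)
  then have bdd: "bdd_below (\<Phi> ` M)" by (intro bdd_belowI2[of _ "- Q"]) force
  have err_norm: "norm (err k \<omega>) \<le> M\<^sub>u + M\<^sub>f" if "\<omega> \<in> space P" for k \<omega>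
    using norm_triangle_ineq4[of "m k \<omega>" "riem_grad M F (x k \<omega>)"] m(2)[OF that, of k] grad_norm[OF xM[OF that], of k]
    by (simp add: err_eq[OF that])
  have int_\<Phi>: "integrable P (\<lambda>\<omega>. \<Phi> (x k \<omega>))" for k
    by (rule integrable_const_bound[where B = Q]) (auto simp: Q xM)
  have int_\<eta>: "integrable P (\<lambda>\<omega>. (norm (\<eta> k \<omega>))\<^sup>2)" for k
    by (rule integrable_const_bound[where B = "d\<^sup>2"]) (auto intro!: AE_I2 power_mono step)
  have int_err: "integrable P (\<lambda>\<omega>. (norm (err k \<omega>))\<^sup>2)" for k
    by (rule integrable_const_bound[where B = "(M\<^sub>u + M\<^sub>f)\<^sup>2"]) (auto intro!: AE_I2 power_mono err_norm)
  have int_\<Delta>: "integrable P (\<Delta> k)" for k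
    by (rule integrable_const_bound[where B = \<Delta>bar]) (use range in \<open>auto intro!: AE_I2\<close>)
  have int_h: "integrable P (h k)" for k
    unfolding h_def using int_\<Phi> int_\<eta> int_err int_\<Delta> by simp
  note dissipation = error_dissipation_expectation[OF prob_space_axioms sub ed int_err int_\<eta>]

  \<comment> \<open>The step inequalities in expectation\<close>
  define a where "a = (\<lambda>k. \<integral>\<omega>. (norm (\<eta> k \<omega>))\<^sup>2 \<partial>P)"
  define b where "b = (\<lambda>k. \<integral>\<omega>. (norm (err k \<omega>))\<^sup>2 \<partial>P)"
  define r where "r = (\<lambda>k. \<integral>\<omega>. Er k \<omega> \<partial>P)"
  define H where "H = (\<lambda>k. \<integral>\<omega>. h k \<omega> \<partial>P)"
  have a0: "0 \<le> a k" and b0: "0 \<le> b k" for k by (simp_all add: a_def b_def)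
  have r0: "0 \<le> r k" for k unfolding r_def by (intro Bochner_Integration.integral_nonneg_AE AE_I2 Er_nonneg)
  have H0: "0 \<le> H k" for k unfolding H_def by (intro Bochner_Integration.integral_nonneg_AE AE_I2 h_nonneg)
  have b_le: "b k \<le> c\<^sub>e * (r k - r (Suc k)) + \<nu> * a k" for k
    using dissipation(2) by (simp add: a_def b_def r_def)
  have H_eq: "H k = (\<integral>\<omega>. \<Phi> (x k \<omega>) \<partial>P) - (\<integral>\<omega>. \<Phi> (x (Suc k) \<omega>) \<partial>P) - \<gamma>0 * (\<sigma>\<^sub>0 - \<tau> / 2) * a k
      + 2 * LC * (\<integral>\<omega>. \<Delta> k \<omega> \<partial>P) + b k / (2 * \<tau>)" for k
    unfolding H_def h_def a_def b_def using int_\<Phi> int_\<eta> int_err int_\<Delta> by simp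
  \<comment> \<open>Capping by \<open>\<Delta>bar\<close> only lowers the tolerance, and a maximum
    of nonnegative numbers is at most their sum; this separates the random part from the summable
    one.\<close>
  have \<Delta>_le: "(\<integral>\<omega>. \<Delta> k \<omega> \<partial>P) \<le> \<kappa> * (if k = 0 then 0 else a (k - 1)) + \<sigma> k" for k
  proof -
    have "(\<integral>\<omega>. \<Delta> k \<omega> \<partial>P) \<le> (\<integral>\<omega>. \<kappa> * (norm (if k = 0 then 0 else \<eta> (k - 1) \<omega>))\<^sup>2 + \<sigma> k \<partial>P)"
    proof (rule integral_mono)
      fix \<omega> assume "\<omega> \<in> space P"
      moreover have "0 \<le> \<kappa> * (norm (if k = 0 then 0 else \<eta> (k - 1) \<omega>))\<^sup>2" "0 \<le> \<sigma> k"
        using \<kappa>_nonneg \<sigma>_range[of k] by auto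
      ultimately show "\<Delta> k \<omega> \<le> \<kappa> * (norm (if k = 0 then 0 else \<eta> (k - 1) \<omega>))\<^sup>2 + \<sigma> k"
        unfolding \<Delta>_eq[OF \<open>\<omega> \<in> space P\<close>] by linarith
    qed (use int_\<Delta> int_\<eta> in \<open>cases "k = 0"; simp\<close>)+
    also have "\<dots> = \<kappa> * (if k = 0 then 0 else a (k - 1)) + \<sigma> k"
      using int_\<eta> by (cases "k = 0") (simp_all add: a_def prob_space)
    finally show ?thesis .
  qed
  have Theta_int: "(\<integral>\<^sup>+\<omega>. ennreal ((Theta F R M (x k \<omega>) (\<eta>hat k \<omega>))\<^sup>2) \<partial>P)
      \<le> ennreal (C\<^sub>\<Theta> / a\<^sub>h * H k + 2 * b k)" for k
  proof -
    \<comment> \<open>Monotonicity of the nonnegative integral asks for no measurability of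
      \<open>Theta\<close>; after this line only measurable functions are integrated.\<close>
    have "(\<integral>\<^sup>+\<omega>. ennreal ((Theta F R M (x k \<omega>) (\<eta>hat k \<omega>))\<^sup>2) \<partial>P)
        \<le> (\<integral>\<^sup>+\<omega>. ennreal (C\<^sub>\<Theta> / a\<^sub>h * h k \<omega> + 2 * (norm (err k \<omega>))\<^sup>2) \<partial>P)"
      by (intro nn_integral_mono ennreal_leI Theta_le)
    also have "\<dots> = ennreal (\<integral>\<omega>. C\<^sub>\<Theta> / a\<^sub>h * h k \<omega> + 2 * (norm (err k \<omega>))\<^sup>2 \<partial>P)"
      using int_h int_err C\<Theta> ah h_nonneg by (intro nn_integral_eq_integral) auto
    also have "(\<integral>\<omega>. C\<^sub>\<Theta> / a\<^sub>h * h k \<omega> + 2 * (norm (err k \<omega>))\<^sup>2 \<partial>P) = C\<^sub>\<Theta> / a\<^sub>h * H k + 2 * b k"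
      unfolding H_def b_def using int_h int_err by simp
    finally show ?thesis .
  qed
  have Cc: "C\<^sub>\<Theta> / a\<^sub>h \<le> Cc" "2 * \<nu> / a\<^sub>\<eta> \<le> Cc" "0 < Cc"
    using c a\<eta> by (auto simp: Cc_eq less_max_iff_disj)

  \<comment> \<open>Summation over the iterations\<close>
  have sum_bound: "(\<Sum>k<K. \<integral>\<^sup>+\<omega>. ennreal ((Theta F R M (x k \<omega>) (\<eta>hat k \<omega>))\<^sup>2) \<partial>P)
      \<le> ennreal (Cc * C' + c\<^sub>e * (2 + Cc / (2 * \<tau>)) * r 0)" if sm: "summable \<sigma>" for K
  proof -
    let ?H = "\<Sum>k<K. H k" and ?a = "\<Sum>k<K. a k" and ?b = "\<Sum>k<K. b k"
    have "?H + a\<^sub>\<eta> * ?a \<le> (\<integral>\<omega>. \<Phi> (x 0 \<omega>) \<partial>P) - (\<integral>\<omega>. \<Phi> (x K \<omega>) \<partial>P) + 2 * LC * (\<Sum>k<K. \<sigma> k) + c\<^sub>e / (2 * \<tau>) * r 0"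
      using telescoped_descent[of H "\<lambda>k. \<integral>\<omega>. \<Phi> (x k \<omega>) \<partial>P" "\<gamma>0 * (\<sigma>\<^sub>0 - \<tau> / 2)" a LC "\<lambda>k. \<integral>\<omega>. \<Delta> k \<omega> \<partial>P" b \<tau>
          \<kappa> \<sigma> c\<^sub>e r \<nu> K] H_eq \<Delta>_le b_le LC \<kappa>_nonneg \<tau> c a0 r0
      by (simp add: a\<^sub>\<eta>_eq LC_def mult.assoc)
    also have "(\<integral>\<omega>. \<Phi> (x 0 \<omega>) \<partial>P) = \<Phi> x0"
      using init by (simp add: prob_space cong: Bochner_Integration.integral_cong)
    finally have "?H + a\<^sub>\<eta> * ?a \<le> \<Phi> x0 - (\<integral>\<omega>. \<Phi> (x K \<omega>) \<partial>P) + 2 * LC * (\<Sum>k<K. \<sigma> k) + c\<^sub>e / (2 * \<tau>) * r 0" .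
    moreover have "2 * LC * (\<Sum>k<K. \<sigma> k) \<le> 2 * LC * (\<Sum>k. \<sigma> k)"
      using LC \<sigma>_range by (intro mult_left_mono sum_le_suminf sm) auto
    moreover have "(INF y\<in>M. \<Phi> y) \<le> (\<integral>\<omega>. \<Phi> (x K \<omega>) \<partial>P)"
      using int_\<Phi> by (intro integral_ge_const) (auto intro!: AE_I2 cINF_lower bdd xM)
    ultimately have total: "?H + a\<^sub>\<eta> * ?a \<le> C' + c\<^sub>e / (2 * \<tau>) * r 0"
      unfolding C'_eq LC_def mult.assoc by linarith
    have "?b \<le> c\<^sub>e * (r 0 - r K) + \<nu> * ?a"
    proof (induction K)
      case (Suc K)
      then show ?case using b_le[of K] by (simp add: algebra_simps)
    qed simp
    also have "\<dots> \<le> c\<^sub>e * r 0 + \<nu> * ?a" using c r0 by simp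
    \<comment> \<open>The origin of \<open>Cc\<close>: with the step sum written as
      \<open>a\<^sub>\<eta> * ?a\<close>, it dominates the coefficients of both parts of
      \<open>?H + a\<^sub>\<eta> * ?a\<close>, the quantity bounded by \<open>total\<close>.\<close>
    finally have "2 * ?b \<le> 2 * c\<^sub>e * r 0 + (2 * \<nu> / a\<^sub>\<eta>) * (a\<^sub>\<eta> * ?a)" using a\<eta> by simp
    also have "\<dots> \<le> 2 * c\<^sub>e * r 0 + Cc * (a\<^sub>\<eta> * ?a)"
      using Cc a\<eta> a0 by (intro add_left_mono mult_right_mono mult_nonneg_nonneg sum_nonneg) auto
    moreover have "C\<^sub>\<Theta> / a\<^sub>h * ?H \<le> Cc * ?H" using Cc H0 by (intro mult_right_mono sum_nonneg) auto
    moreover have "Cc * (?H + a\<^sub>\<eta> * ?a) \<le> Cc * (C' + c\<^sub>e / (2 * \<tau>) * r 0)"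
      using total Cc by (intro mult_left_mono) auto
    ultimately have le: "C\<^sub>\<Theta> / a\<^sub>h * ?H + 2 * ?b \<le> Cc * C' + c\<^sub>e * (2 + Cc / (2 * \<tau>)) * r 0"
      by (simp add: algebra_simps)
    have "(\<Sum>k<K. \<integral>\<^sup>+\<omega>. ennreal ((Theta F R M (x k \<omega>) (\<eta>hat k \<omega>))\<^sup>2) \<partial>P)
        \<le> (\<Sum>k<K. ennreal (C\<^sub>\<Theta> / a\<^sub>h * H k + 2 * b k))"
      by (intro sum_mono Theta_int)
    also have "\<dots> = ennreal (\<Sum>k<K. C\<^sub>\<Theta> / a\<^sub>h * H k + 2 * b k)"
      using C\<Theta> ah H0 b0 by (intro sum_ennreal) simp
    also have "(\<Sum>k<K. C\<^sub>\<Theta> / a\<^sub>h * H k + 2 * b k) = C\<^sub>\<Theta> / a\<^sub>h * ?H + 2 * ?b"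
      by (simp add: sum.distrib sum_distrib_left)
    finally show ?thesis using le by (meson ennreal_leI order_trans)
  qed

  \<comment> \<open>Iteration complexity\<close>
  have "\<exists>N :: real \<Rightarrow> nat.
      (\<lambda>\<epsilon>. real (N \<epsilon>)) \<in> O[at_right 0](\<lambda>\<epsilon>. (Cc + c\<^sub>e * (1 + Cc / \<tau>) * r 0) / \<epsilon>\<^sup>2) \<and>
      (\<forall>\<epsilon>>0. 1 \<le> N \<epsilon> \<and>
        real (N \<epsilon>) \<le> max 2 C' * (Cc + c\<^sub>e * (1 + Cc / \<tau>) * r 0) / \<epsilon>\<^sup>2 + 1 \<and>
        (MIN k\<in>{..<N \<epsilon>}. \<integral>\<^sup>+\<omega>. ennreal ((Theta F R M (x k \<omega>) (\<eta>hat k \<omega>))\<^sup>2) \<partial>P) \<le> ennreal (\<epsilon>\<^sup>2))"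
    if "summable \<sigma>"
  \<comment> \<open>In the factor \<open>max 2 C'\<close>, the entry \<open>C'\<close> covers
    \<open>Cc * C'\<close>, and 2 covers the initial error because
    \<open>2 + Cc / (2 * \<tau>) \<le> 2 * (1 + Cc / \<tau>)\<close>.\<close>
  proof (rule iteration_count[OF sum_bound[OF that]])
    define s where "s = c\<^sub>e * (1 + Cc / \<tau>) * r 0"
    have s: "0 \<le> s" using c Cc \<tau> r0 by (simp add: s_def)
    have "c\<^sub>e * (2 + Cc / (2 * \<tau>)) * r 0 \<le> c\<^sub>e * (2 * (1 + Cc / \<tau>)) * r 0"
      using c Cc \<tau> r0 by (intro mult_right_mono mult_left_mono) (simp_all add: field_simps)
    also have "\<dots> = 2 * s" by (simp add: s_def)
    also have "\<dots> \<le> max 2 C' * s" using s by (intro mult_right_mono) auto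
    finally have "c\<^sub>e * (2 + Cc / (2 * \<tau>)) * r 0 \<le> max 2 C' * s" .
    moreover have "Cc * C' \<le> Cc * max 2 C'" using Cc by (intro mult_left_mono) auto
    ultimately show "Cc * C' + c\<^sub>e * (2 + Cc / (2 * \<tau>)) * r 0 \<le> max 2 C' * (Cc + c\<^sub>e * (1 + Cc / \<tau>) * r 0)"
      unfolding s_def[symmetric] unfolding distrib_left mult.commute[of "max 2 C'" Cc] by linarith
    show "0 < Cc + c\<^sub>e * (1 + Cc / \<tau>) * r 0" using s Cc by (simp flip: s_def)
  qed simp
  with a\<eta> sum_bound show ?thesis unfolding r_def by blast
qed

end
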